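(* Assume the setting described in the context, with scaling exponent $\beta>0$. Then $\mathbf P$-almost surely (that is, for almost every realization of $Z$), for any fixed $t>0$, as $\varepsilon\to0$, $$\frac{N^{\varepsilon}(t)}{m^{\varepsilon}(t)}\longrightarrow 1\quad\text{in }\mathbb P_Z\text{-probability},$$ i.e. $\mathbf P$-almost surely, for all $\delta>0$, $$\lim_{\varepsilon\to0}\mathbb P_Z\left(\left|\frac{N^{\varepsilon}(t)}{m^{\varepsilon}(t)}-1\right|\ge\delta\right)=0 .$$ In addition, as $\varepsilon\to0$, $$\frac{\varepsilon^{\beta}N^{\varepsilon}(t)}{\bar m_0(t)}\longrightarrow1\quad\text{in }\mathbb P_Z\text{-probability}.$$
   Context: Environment. $Z=\{Z_t;t\ge0\}$ is an $\mathbb R^d$-valued stochastic process with right-continuous paths with left limits on a probability space $(\Omega,\mathcal F,\mathbb P)$; it has a unique invariant probability measure $\pi$. $\mathbf P$ denotes the law of $Z$ (used also for probabilities of events depending only on $Z$). $\mathbb P_Z=\mathbb P(\cdot\mid Z)$ and $\mathbb E_Z=\mathbb E(\cdot\mid Z)$ are the quenched probability and expectation. The functions $\lambda:[0,\infty)\to\mathbb R_+$ and $\psi:\mathbb R^d\to\mathbb R_+$ are positive, bounded and Lipschitz, and $\bar\psi=\int_{\mathbb R^d}\psi(z)\,\pi(dz)$. Ergodicity: for every $\kappa\in(0,\tfrac12)$ there is a finite random variable $C=C_{\kappa,\psi}(Z)>0$ such that $\mathbf P$-almost surely, for all $t>0$, $\left|\frac1t\int_0^t\psi(Z_u)\,du-\bar\psi\right|\le\frac{C}{(1+t)^{\kappa}}$.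 Service times. $\{\nu(s,dr);s\ge0\}$ is a family of probability laws on $[0,\infty)$ with densities, $\nu(s,dr)=\ell_s(r)\,dr$, and there are $\alpha>0$ and constants $c,C>0$ such that for all $r,s>0$: $c\,(r^{-1-\alpha}\wedge1)\le\ell_s(r)\le C\,(r^{-1-\alpha}\wedge1)$ and $\frac{\partial\ell_s(r)}{\partial s}\le C\,(r^{-1-\alpha}\wedge1)$. Set $\bar F_s(r)=\int_r^\infty\ell_s(\tau)\,d\tau$. Queue. For $\varepsilon>0$, conditionally on $Z$ the arrival times $\{\Gamma^\varepsilon_k;k\ge1\}$ form a Poisson process on $[0,\infty)$ with intensity $\mu^\varepsilon(ds)=\varepsilon^{-\beta}\lambda(s)\psi(Z_{s/\varepsilon})\,ds$; conditionally on $Z$ and the arrival times, the service times $L^\varepsilon_k$ are independent with $L^\varepsilon_k\sim\nu(\Gamma^\varepsilon_k,\cdot)$. The number of active jobs is $N^\varepsilon(t)=\sum_{k\ge1}\mathbf 1_{\{\Gamma^\varepsilon_k<t<\Gamma^\varepsilon_k+L^\varepsilon_k\}}$. Its quenched mean is $m^\varepsilon(t)=\mathbb E_Z[N^\varepsilon(t)]=\varepsilon^{-\beta}\int_0^t\lambda(s)\bar F_s(t-s)\psi(Z_{s/\varepsilon})\,ds$, and $\bar m_0(t)=\bar\psi\int_0^t\lambda(s)\bar F_s(t-s)\,ds$. *)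

theory Defs
  imports "HOL-Probability.Probability"
begin

section \<open>Generated sigma-algebras and convergence in probability\<close>

definition sigma_rvs :: "'a measure \<Rightarrow> 'i set \<Rightarrow> ('i \<Rightarrow> 'a \<Rightarrow> 'b::topological_space) \<Rightarrow> 'a measure" where
  "sigma_rvs M I X = sigma (space M) (\<Union>i\<in>I. {X i -` B \<inter> space M | B. B \<in> sets borel})"

definition converges_in_prob :: "'a measure \<Rightarrow> ('i \<Rightarrow> 'a \<Rightarrow> real) \<Rightarrow> real \<Rightarrow> 'i filter \<Rightarrow> bool" where
  "converges_in_prob P X c F \<longleftrightarrow>
     (\<forall>\<delta>>0. ((\<lambda>i. measure P {x \<in> space P. \<delta> \<le> \<bar>X i x - c\<bar>}) \<longlongrightarrow> 0) F)"

section \<open>Poisson arrivals and service times\<close>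

text \<open>
  Arrival times take values in \<open>[0, \<infinity>]\<close>: the intensity may have finite total mass, in which case there
  are almost surely only finitely many arrivals, and \<open>\<Gamma> k x = \<infinity>\<close> means that job \<open>k\<close> does not exist.
  Jobs are indexed from \<open>0\<close>. No ordering of the labels is imposed.
\<close>

definition num_arrivals :: "(nat \<Rightarrow> 'a \<Rightarrow> ennreal) \<Rightarrow> real set \<Rightarrow> 'a \<Rightarrow> ennreal" where
  "num_arrivals \<Gamma> A x = emeasure (count_space UNIV) {k. \<Gamma> k x < \<infinity> \<and> enn2real (\<Gamma> k x) \<in> A}"

text \<open>
  The Poisson probabilities are written out because \<^const>\<open>poisson_pmf\<close> is only specified for positive
  rates, whereas \<open>\<mu> A = 0\<close> must be allowed here.
\<close>

definition poisson_process :: "'a measure \<Rightarrow> (nat \<Rightarrow> 'a \<Rightarrow> ennreal) \<Rightarrow> real measure \<Rightarrow> bool" where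
  "poisson_process P \<Gamma> \<mu> \<longleftrightarrow>
     (\<forall>A \<in> sets borel. emeasure \<mu> A < \<infinity> \<longrightarrow>
        (\<forall>n. measure P {x \<in> space P. num_arrivals \<Gamma> A x = of_nat n}
               = measure \<mu> A ^ n / fact n * exp (- measure \<mu> A))) \<and>
     (\<forall>n. \<forall>A :: nat \<Rightarrow> real set.
        (\<forall>i<n. A i \<in> sets borel \<and> emeasure \<mu> (A i) < \<infinity>) \<and> disjoint_family_on A {..<n} \<longrightarrow>
        prob_space.indep_vars P (\<lambda>_. borel) (\<lambda>i. num_arrivals \<Gamma> (A i)) {..<n})"

definition service_law :: "(real \<Rightarrow> real \<Rightarrow> real) \<Rightarrow> real \<Rightarrow> real measure" where
  "service_law ell s = density lborel (\<lambda>r. ennreal (indicator {0..} r * ell s r))"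

definition survival :: "(real \<Rightarrow> real \<Rightarrow> real) \<Rightarrow> real \<Rightarrow> real \<Rightarrow> real" where
  "survival ell s r = (LBINT \<tau>:{r..}. ell s \<tau>)"

text \<open>
  Given the arrival times, the service times of the existing jobs are independent with laws
  \<open>service_law ell (\<Gamma> k)\<close>. Nothing is required of \<open>L k x\<close> where \<open>\<Gamma> k x = \<infinity>\<close>.
\<close>

definition service_times ::
  "'a measure \<Rightarrow> (real \<Rightarrow> real \<Rightarrow> real) \<Rightarrow> (nat \<Rightarrow> 'a \<Rightarrow> ennreal) \<Rightarrow> (nat \<Rightarrow> 'a \<Rightarrow> real) \<Rightarrow> bool" where
  "service_times P ell \<Gamma> L \<longleftrightarrow>
     (\<forall>J B. finite J \<and> (\<forall>k\<in>J. B k \<in> sets borel) \<longrightarrow>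
        (AE x in P.
           real_cond_exp P (sigma_rvs P UNIV \<Gamma>)
             (indicator {y \<in> space P. \<forall>k\<in>J. \<Gamma> k y < \<infinity> \<and> L k y \<in> B k}) x
           = (\<Prod>k\<in>J. of_bool (\<Gamma> k x < \<infinity>) * measure (service_law ell (enn2real (\<Gamma> k x))) (B k))))"

text \<open>
  The sum has almost surely finitely many nonzero terms; its value where it diverges is irrelevant.
\<close>

definition active_jobs ::
  "(nat \<Rightarrow> 'a \<Rightarrow> ennreal) \<Rightarrow> (nat \<Rightarrow> 'a \<Rightarrow> real) \<Rightarrow> real \<Rightarrow> 'a \<Rightarrow> real" where
  "active_jobs \<Gamma> L t x =
     (\<Sum>k. of_bool (\<Gamma> k x < ennreal t \<and> ennreal t < \<Gamma> k x + ennreal (L k x)))"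

section \<open>The random environment\<close>

text \<open>
  \<open>K t z\<close> is the law of the environment \<open>t\<close> time units after it was in state \<open>z\<close>; a probability
  measure is invariant if it is preserved by all \<open>K t\<close>. No Markov property is required of \<open>Z\<close>.
\<close>

definition invariant_prob ::
  "(real \<Rightarrow> 'b::topological_space \<Rightarrow> 'b measure) \<Rightarrow> 'b measure \<Rightarrow> bool" where
  "invariant_prob K \<pi> \<longleftrightarrow> \<pi> \<in> space (prob_algebra borel) \<and> (\<forall>t\<ge>0. \<pi> \<bind> K t = \<pi>)"

locale random_environment = prob_space M
  for M :: "'a measure"
    and Z :: "real \<Rightarrow> 'a \<Rightarrow> real ^ 'd"
    and K :: "real \<Rightarrow> real ^ 'd \<Rightarrow> (real ^ 'd) measure"
    and \<pi> :: "(real ^ 'd) measure" +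
  assumes Z_measurable: "t \<ge> 0 \<Longrightarrow> Z t \<in> borel_measurable M"
    and Z_right_continuous: "\<omega> \<in> space M \<Longrightarrow> t \<ge> 0 \<Longrightarrow> continuous (at_right t) (\<lambda>s. Z s \<omega>)"
    and Z_left_limits: "\<omega> \<in> space M \<Longrightarrow> t > 0 \<Longrightarrow> \<exists>l. ((\<lambda>s. Z s \<omega>) \<longlongrightarrow> l) (at_left t)"
    and K_kernel: "t \<ge> 0 \<Longrightarrow> K t \<in> borel \<rightarrow>\<^sub>M prob_algebra borel"
    and Z_transition: "s \<ge> 0 \<Longrightarrow> t \<ge> 0 \<Longrightarrow> B \<in> sets borel \<Longrightarrow>
      AE \<omega> in M. real_cond_exp M (sigma_rvs M {s} Z) (indicator {\<omega>' \<in> space M. Z (s + t) \<omega>' \<in> B}) \<omega>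
                   = measure (K t (Z s \<omega>)) B"
    and \<pi>_invariant: "invariant_prob K \<pi>"
    and \<pi>_unique: "invariant_prob K \<pi>' \<Longrightarrow> \<pi>' = \<pi>"

section \<open>The queue in the random environment\<close>

definition arrival_intensity ::
  "real \<Rightarrow> (real \<Rightarrow> real) \<Rightarrow> ('b \<Rightarrow> real) \<Rightarrow> (real \<Rightarrow> 'b) \<Rightarrow> real \<Rightarrow> real measure" where
  "arrival_intensity \<beta> lam \<psi> z \<epsilon> =
     density lborel (\<lambda>s. ennreal (indicator {0..} s * (\<epsilon> powr (- \<beta>) * lam s * \<psi> (z (s / \<epsilon>)))))"

text \<open>
  \<open>Q \<omega>\<close> is the quenched probability \<open>P\<^sub>Z\<close>, a regular conditional probability given the sigma-algebra
  generated by \<open>Z\<close>. The conditional laws of arrivals and services are prescribed under \<open>Q \<omega>\<close> for all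
  scales \<open>\<epsilon>\<close> simultaneously outside one null set of environments: quenched limits run over uncountably
  many \<open>\<epsilon>\<close>, so scale-dependent null sets would leave them undetermined.
\<close>

locale queue_in_random_environment = random_environment M Z K \<pi>
  for M :: "'a measure"
    and Z :: "real \<Rightarrow> 'a \<Rightarrow> real ^ 'd"
    and K :: "real \<Rightarrow> real ^ 'd \<Rightarrow> (real ^ 'd) measure"
    and \<pi> :: "(real ^ 'd) measure" +
  fixes lam :: "real \<Rightarrow> real"
    and \<psi> :: "real ^ 'd \<Rightarrow> real"
    and ell :: "real \<Rightarrow> real \<Rightarrow> real"
    and \<alpha> \<beta> :: real
    and Q :: "'a \<Rightarrow> 'a measure"
    and \<Gamma> :: "real \<Rightarrow> nat \<Rightarrow> 'a \<Rightarrow> ennreal"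
    and L :: "real \<Rightarrow> nat \<Rightarrow> 'a \<Rightarrow> real"
  assumes lam_positive: "s \<ge> 0 \<Longrightarrow> lam s > 0"
    and lam_bounded: "bounded (lam ` {0..})"
    and lam_lipschitz: "\<exists>C. C-lipschitz_on {0..} lam"
    and \<psi>_positive: "\<psi> z > 0"
    and \<psi>_bounded: "bounded (range \<psi>)"
    and \<psi>_lipschitz: "\<exists>C. C-lipschitz_on UNIV \<psi>"
    and ergodicity: "0 < \<kappa> \<Longrightarrow> \<kappa> < 1/2 \<Longrightarrow>
      \<exists>C. C \<in> borel_measurable (sigma_rvs M {0..} Z) \<and> (\<forall>\<omega> \<in> space M. C \<omega> > (0::real)) \<and>
        (AE \<omega> in M. \<forall>t>0.
           \<bar>(1 / t) * (LBINT u:{0..t}. \<psi> (Z u \<omega>)) - (\<integral>z. \<psi> z \<partial>\<pi>)\<bar> \<le> C \<omega> / (1 + t) powr \<kappa>)"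
    and ell_measurable: "s \<ge> 0 \<Longrightarrow> set_borel_measurable borel {0..} (ell s)"
    and ell_nonneg: "s \<ge> 0 \<Longrightarrow> r \<ge> 0 \<Longrightarrow> ell s r \<ge> 0"
    and service_law_prob: "s \<ge> 0 \<Longrightarrow> prob_space (service_law ell s)"
    and \<alpha>_positive: "\<alpha> > 0"
    and ell_bounds: "\<exists>c>0. \<exists>C>0. \<forall>r>0. \<forall>s>0.
      c * min (r powr (- 1 - \<alpha>)) 1 \<le> ell s r \<and> ell s r \<le> C * min (r powr (- 1 - \<alpha>)) 1 \<and>
      (\<exists>D. ((\<lambda>u. ell u r) has_real_derivative D) (at s) \<and> D \<le> C * min (r powr (- 1 - \<alpha>)) 1)"
    and \<beta>_positive: "\<beta> > 0"
    and Q_kernel: "Q \<in> sigma_rvs M {0..} Z \<rightarrow>\<^sub>M prob_algebra M"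
    and Q_cond_prob: "A \<in> sets M \<Longrightarrow>
      AE \<omega> in M. real_cond_exp M (sigma_rvs M {0..} Z) (indicator A) \<omega> = measure (Q \<omega>) A"
    and \<Gamma>_measurable: "\<epsilon> > 0 \<Longrightarrow> \<Gamma> \<epsilon> k \<in> borel_measurable M"
    and L_measurable: "\<epsilon> > 0 \<Longrightarrow> L \<epsilon> k \<in> borel_measurable M"
    and arrivals: "AE \<omega> in M. \<forall>\<epsilon>>0.
      poisson_process (Q \<omega>) (\<Gamma> \<epsilon>) (arrival_intensity \<beta> lam \<psi> (\<lambda>u. Z u \<omega>) \<epsilon>)"
    and services: "AE \<omega> in M. \<forall>\<epsilon>>0. service_times (Q \<omega>) ell (\<Gamma> \<epsilon>) (L \<epsilon>)"

definition quenched_mean ::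
  "'a measure \<Rightarrow> (nat \<Rightarrow> 'a \<Rightarrow> ennreal) \<Rightarrow> (nat \<Rightarrow> 'a \<Rightarrow> real) \<Rightarrow> real \<Rightarrow> real" where
  "quenched_mean P \<Gamma> L t = (\<integral>x. active_jobs \<Gamma> L t x \<partial>P)"

definition averaged_mean ::
  "'b measure \<Rightarrow> (real \<Rightarrow> real) \<Rightarrow> ('b \<Rightarrow> real) \<Rightarrow> (real \<Rightarrow> real \<Rightarrow> real) \<Rightarrow> real \<Rightarrow> real" where
  "averaged_mean \<pi> lam \<psi> ell t = (\<integral>z. \<psi> z \<partial>\<pi>) * (LBINT s:{0..t}. lam s * survival ell s (t - s))"

end

(* Campbell's formulas for the first and second factorial moment measures, applied to the arrivals
   marked with their service times, show that under the quenched law the number of active jobs has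
   variance equal to its mean m. Hence E (a N - c)^2 = a^2 m + (a m - c)^2, and Chebyshev's inequality
   gives both convergences as soon as eps^beta m tends to the averaged mean, which is positive. The
   latter is an averaging principle: by ergodicity the measures psi(Z (s / eps)) ds on [0, t] converge
   weakly to psi-bar ds, and the limiting integrand is continuous on (0, t) by dominated convergence. *)

theory Submission
  imports Defs
begin

section \<open>Campbell's formulas for Poisson arrivals\<close>

text \<open>The arrivals are known only through counts of Borel sets and their labels carry no
  order, so no individual arrival has a known law; only sums over all labels, or over all pairs of
  distinct labels, can be evaluated. Hence the moment formulas are rebuilt from Poisson counts, and
  everything up to the moments stays in \<open>ennreal\<close>, where such sums may be rearranged
  freely. Services are given through conditional probabilities of rectangles, while outliving time t
  is the condition t < arrival + service, which is no rectangle; a disintegration over the arrival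
  time closes this gap. Pairs of distinct jobs then contribute exactly m^2 and the diagonal m,
  whence variance = mean. With a = 1/m and c = 1 the bound has order 1/m, that is eps^beta. The
  limiting integrand is controlled on the open interval (0, t) only, since the derivative of
  \<open>ell\<close> is assumed at positive s; the endpoints are Lebesgue null. The exceptional
  environments are fixed before t and eps, and the rest of the argument concerns a single path of
  \<open>Z\<close>.\<close>

lemma suminf_nn_integral_transfer:
  fixes W :: "nat \<Rightarrow> 'a \<Rightarrow> ennreal" and X :: "nat \<Rightarrow> 'a \<Rightarrow> 'b"
  assumes [measurable]: "\<And>k. W k \<in> borel_measurable P" "\<And>k. X k \<in> P \<rightarrow>\<^sub>M N"
    and base: "\<And>A. A \<in> sets N \<Longrightarrow>
      (\<Sum>k. \<integral>\<^sup>+x. W k x * indicator A (X k x) \<partial>P) = c * emeasure N A"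
    and f: "f \<in> borel_measurable N"
  shows "(\<Sum>k. \<integral>\<^sup>+x. W k x * f (X k x) \<partial>P) = c * (\<integral>\<^sup>+s. f s \<partial>N)"
  using f
\<comment> \<open>Both sides are additive, homogeneous and continuous along increasing sequences in
  \<open>f\<close>. The weights \<open>W k\<close> allow a second coordinate to be frozen inside
  them, whose total mass then appears as \<open>c\<close>.\<close>
proof (induction f rule: borel_measurable_induct)
  case (cong f g)
  have "f (X k x) = g (X k x)" if "x \<in> space P" for k x
    using cong(3) measurable_space[OF assms(2) that] by auto
  then have "(\<integral>\<^sup>+x. W k x * f (X k x) \<partial>P) = (\<integral>\<^sup>+x. W k x * g (X k x) \<partial>P)" for k
    by (intro nn_integral_cong) auto
  moreover have "(\<integral>\<^sup>+s. f s \<partial>N) = (\<integral>\<^sup>+s. g s \<partial>N)"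
    using cong(3) by (intro nn_integral_cong) auto
  ultimately show ?case using cong by simp
next
  case (set A)
  then show ?case using base by simp
next
  case (mult u d)
  have [measurable]: "u \<in> borel_measurable N" by fact
  have "(\<integral>\<^sup>+x. W k x * (d * u (X k x)) \<partial>P) = d * (\<integral>\<^sup>+x. W k x * u (X k x) \<partial>P)" for k
    by (subst nn_integral_cmult[symmetric]) (auto simp: mult_ac)
  then show ?case
    using mult by (simp add: nn_integral_cmult mult_ac)
next
  case (add u v)
  have [measurable]: "u \<in> borel_measurable N" "v \<in> borel_measurable N" by fact+
  have "(\<integral>\<^sup>+x. W k x * (v (X k x) + u (X k x)) \<partial>P)
    = (\<integral>\<^sup>+x. W k x * v (X k x) \<partial>P) + (\<integral>\<^sup>+x. W k x * u (X k x) \<partial>P)" for k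
    by (subst nn_integral_add[symmetric]) (auto simp: distrib_left)
  then show ?case
    using add by (simp add: nn_integral_add distrib_left flip: suminf_add)
next
  case (seq U)
  have [measurable]: "\<And>i. U i \<in> borel_measurable N" by fact
  have inc: "incseq (\<lambda>i x. W k x * U i (X k x))" for k
    using seq(3) by (auto simp: incseq_def le_fun_def intro!: mult_left_mono)
  have "(\<integral>\<^sup>+x. W k x * (SUP i. U i) (X k x) \<partial>P) = (SUP i. \<integral>\<^sup>+x. W k x * U i (X k x) \<partial>P)" for k
    by (subst nn_integral_monotone_convergence_SUP[symmetric, OF inc])
       (auto simp: SUP_mult_left_ennreal image_comp)
  moreover have "(\<Sum>k. (SUP i. \<integral>\<^sup>+x. W k x * U i (X k x) \<partial>P))
      = (SUP i. (\<Sum>k. \<integral>\<^sup>+x. W k x * U i (X k x) \<partial>P))"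
    using inc by (intro ennreal_suminf_SUP_eq incseq_nn_integral)
  moreover have "(\<integral>\<^sup>+s. (SUP i. U i) s \<partial>N) = (SUP i. \<integral>\<^sup>+s. U i s \<partial>N)"
    using nn_integral_monotone_convergence_SUP[OF seq(3)] by (simp add: image_comp)
  ultimately show ?case
    using seq by (simp add: SUP_mult_left_ennreal)
qed

lemma num_arrivals_eq_suminf:
  "num_arrivals \<Gamma> A x = (\<Sum>k. of_bool (\<Gamma> k x < \<infinity> \<and> enn2real (\<Gamma> k x) \<in> A))"
proof -
  have "num_arrivals \<Gamma> A x = (\<integral>\<^sup>+k. indicator {k. \<Gamma> k x < \<infinity> \<and> enn2real (\<Gamma> k x) \<in> A} k \<partial>count_space UNIV)"
    unfolding num_arrivals_def by simp
  also have "\<dots> = (\<Sum>k. indicator {k. \<Gamma> k x < \<infinity> \<and> enn2real (\<Gamma> k x) \<in> A} k)"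
    by (rule nn_integral_count_space_nat)
  finally show ?thesis by (simp add: indicator_def of_bool_def)
qed

section \<open>Poisson moments and series of extended reals\<close>

lemma suminf_poisson_moments:
  fixes m :: real
  assumes "m \<ge> 0"
  shows "(\<Sum>n. ennreal (m ^ n / fact n * exp (- m))) = 1"
    and "(\<Sum>n. of_nat n * ennreal (m ^ n / fact n * exp (- m))) = ennreal m"
    and "(\<Sum>n. of_nat n * of_nat n * ennreal (m ^ n / fact n * exp (- m))) = ennreal (m + m\<^sup>2)"
proof -
  \<comment> \<open>With p n the Poisson weight, (n+1) p (n+1) = m p n. Each moment series, shifted
    by one, thus reduces to the moments below it; the term n = 0 vanishes.\<close>
  have fact: "real (Suc n) * (m ^ Suc n / fact (Suc n) * exp (- m)) = m * (m ^ n / fact n * exp (- m))" for n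
  proof -
    have "real (Suc n) / fact (Suc n) = (1 / fact n :: real)"
      by (simp del: of_nat_Suc)
    then show ?thesis
      by (metis (no_types, opaque_lifting) mult.assoc mult.commute power_Suc times_divide_eq_left
          times_divide_eq_right mult_1)
  qed
  have s: "(\<lambda>n. m ^ n / fact n) sums exp m"
    using exp_converges[of m] by (simp add: field_simps)
  have s0: "(\<lambda>n. m ^ n / fact n * exp (- m)) sums 1"
    using sums_mult2[OF s, of "exp (- m)"] by (simp flip: exp_add)
  have s1: "(\<lambda>n. real n * (m ^ n / fact n * exp (- m))) sums m"
  proof (rule sums_Suc_imp)
    show "(\<lambda>n. real (Suc n) * (m ^ Suc n / fact (Suc n) * exp (- m))) sums m"
      unfolding fact using sums_mult[OF s0, of m] by simp
  qed simp
  have s2: "(\<lambda>n. real n * real n * (m ^ n / fact n * exp (- m))) sums (m + m\<^sup>2)"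
  proof (rule sums_Suc_imp)
    have "real (Suc n) * real (Suc n) * (m ^ Suc n / fact (Suc n) * exp (- m))
        = m * (real n * (m ^ n / fact n * exp (- m))) + m * (m ^ n / fact n * exp (- m))" for n
      unfolding mult.assoc fact by (simp add: algebra_simps add_divide_distrib)
    then show "(\<lambda>n. real (Suc n) * real (Suc n) * (m ^ Suc n / fact (Suc n) * exp (- m))) sums (m + m\<^sup>2)"
      using sums_add[OF sums_mult[OF s1, of m] sums_mult[OF s0, of m]]
      by (simp add: power2_eq_square add.commute)
  qed simp
  show "(\<Sum>n. ennreal (m ^ n / fact n * exp (- m))) = 1"
    using assms s0 by (subst suminf_ennreal_eq) auto
  have e: "of_nat n * ennreal y = ennreal (real n * y)" for n y
    by (simp add: ennreal_mult' ennreal_of_nat_eq_real_of_nat)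
  show "(\<Sum>n. of_nat n * ennreal (m ^ n / fact n * exp (- m))) = ennreal m"
    unfolding e using assms s1 by (subst suminf_ennreal_eq) auto
  show "(\<Sum>n. of_nat n * of_nat n * ennreal (m ^ n / fact n * exp (- m))) = ennreal (m + m\<^sup>2)"
    unfolding mult.assoc e using assms s2 by (subst suminf_ennreal_eq) (auto simp: mult.assoc)
qed

text \<open>
  The probabilities of the finite values already add up to one, so infinite counts are null and
  every moment is the corresponding series.
\<close>

lemma (in prob_space) nn_integral_poisson:
  fixes N :: "'a \<Rightarrow> ennreal" and m :: real
  assumes [measurable]: "N \<in> borel_measurable M" and g: "g \<in> borel_measurable borel" and "m \<ge> 0"
    and pois: "\<And>n. prob {x \<in> space M. N x = of_nat n} = m ^ n / fact n * exp (- m)"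
  shows "AE x in M. N x < \<infinity>"
    and "(\<integral>\<^sup>+x. g (N x) \<partial>M) = (\<Sum>n. g (of_nat n) * ennreal (m ^ n / fact n * exp (- m)))"
proof -
  note [measurable] = g
  let ?E = "\<lambda>n. {x \<in> space M. N x = of_nat n}"
  have disj: "disjoint_family ?E"
    by (auto simp: disjoint_family_on_def)
  have "emeasure M (\<Union>n. ?E n) = (\<Sum>n. emeasure M (?E n))"
    using disj by (intro suminf_emeasure[symmetric]) auto
  also have "\<dots> = 1"
    using suminf_poisson_moments(1)[OF \<open>m \<ge> 0\<close>] by (simp add: emeasure_eq_measure pois)
  finally have "prob (\<Union>n. ?E n) = 1"
    by (simp add: emeasure_eq_measure)
  then have AE: "AE x in M. x \<in> (\<Union>n. ?E n)"
    by (rule AE_prob_1)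
  then show "AE x in M. N x < \<infinity>"
    by eventually_elim (auto simp: of_nat_less_top)
  have "(\<integral>\<^sup>+x. g (N x) \<partial>M) = (\<integral>\<^sup>+x. (\<Sum>n. g (of_nat n) * indicator (?E n) x) \<partial>M)"
  proof (rule nn_integral_cong_AE, use AE in eventually_elim)
    case (elim x)
    then obtain n where n: "x \<in> space M" "N x = of_nat n" by auto
    have ind: "indicator (?E k) x = (of_bool (k = n) :: ennreal)" for k
      unfolding indicator_def mem_Collect_eq n(2) of_nat_eq_iff using n(1) by auto
    have "(\<Sum>k. g (of_nat k) * of_bool (k = n)) = (\<Sum>k\<in>{n}. g (of_nat k) * of_bool (k = n))"
      by (rule suminf_finite) auto
    then show ?case unfolding ind n(2) by simp
  qed
  also have "\<dots> = (\<Sum>n. g (of_nat n) * emeasure M (?E n))"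
    by (subst nn_integral_suminf) (auto simp: nn_integral_cmult_indicator)
  finally show "(\<integral>\<^sup>+x. g (N x) \<partial>M) = (\<Sum>n. g (of_nat n) * ennreal (m ^ n / fact n * exp (- m)))"
    by (simp add: emeasure_eq_measure pois)
qed

text \<open>A product of two sums over labels splits into pairs of distinct labels and the diagonal.
  The additive form avoids subtraction in \<open>ennreal\<close>.\<close>

lemma suminf_off_diagonal:
  fixes f g :: "nat \<Rightarrow> ennreal"
  shows "(\<Sum>k. f k) * (\<Sum>j. g j) = (\<Sum>k. \<Sum>j. of_bool (k \<noteq> j) * (f k * g j)) + (\<Sum>k. f k * g k)"
proof -
  have "(\<Sum>j. f k * g j) = (\<Sum>j. of_bool (k \<noteq> j) * (f k * g j)) + f k * g k" for k
  proof -
    have "(\<Sum>j. f k * g j) = (\<Sum>j. of_bool (k \<noteq> j) * (f k * g j) + of_bool (k = j) * (f k * g j))"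
      by (intro suminf_cong) auto
    also have "\<dots> = (\<Sum>j. of_bool (k \<noteq> j) * (f k * g j)) + (\<Sum>j. of_bool (k = j) * (f k * g j))"
      by (intro suminf_add[symmetric]) auto
    also have "(\<Sum>j. of_bool (k = j) * (f k * g j)) = (\<Sum>j\<in>{k}. of_bool (k = j) * (f k * g j))"
      by (intro suminf_finite) auto
    finally show ?thesis by simp
  qed
  then have "(\<Sum>k. \<Sum>j. f k * g j) = (\<Sum>k. (\<Sum>j. of_bool (k \<noteq> j) * (f k * g j)) + f k * g k)"
    by simp
  also have "\<dots> = (\<Sum>k. \<Sum>j. of_bool (k \<noteq> j) * (f k * g j)) + (\<Sum>k. f k * g k)"
    by (intro suminf_add[symmetric]) auto
  finally show ?thesis by simp
qed

lemma suminf_swap_ennreal: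
  fixes f :: "nat \<Rightarrow> nat \<Rightarrow> ennreal"
  shows "(\<Sum>k. \<Sum>j. f k j) = (\<Sum>j. \<Sum>k. f k j)"
proof -
  have "(\<Sum>k. \<integral>\<^sup>+j. f k j \<partial>count_space UNIV) = (\<integral>\<^sup>+j. (\<Sum>k. f k j) \<partial>count_space UNIV)"
    by (rule nn_integral_suminf[symmetric]) auto
  then show ?thesis by (simp add: nn_integral_count_space_nat)
qed

text \<open>Only jobs arriving before the observation time \<open>T\<close> can be active at
  \<open>T\<close>. Truncating there makes the intensity finite, so that counts have finite moments
  and terms may be cancelled in \<open>ennreal\<close>.\<close>

locale poisson_arrivals = prob_space P
  for P :: "'a measure" and \<Gamma> :: "nat \<Rightarrow> 'a \<Rightarrow> ennreal" and \<mu> :: "real measure" +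
  fixes T :: real
  assumes \<Gamma>_borel [measurable]: "\<And>k. \<Gamma> k \<in> borel_measurable P"
    and sets_\<mu>: "sets \<mu> = sets borel"
    and poisson: "poisson_process P \<Gamma> \<mu>"
    and finite_\<mu>: "emeasure \<mu> {..<T} < \<infinity>"
begin

definition pos :: "nat \<Rightarrow> 'a \<Rightarrow> real" where
  "pos k x = enn2real (\<Gamma> k x)"

text \<open>\<open>enn2real\<close> sends infinity to 0, so \<open>pos k x\<close> is 0 for a job
  that does not exist; the finiteness test removes such spurious points.\<close>

definition arrived :: "nat \<Rightarrow> 'a \<Rightarrow> ennreal" where
  "arrived k x = of_bool (\<Gamma> k x < \<infinity> \<and> pos k x < T)"

definition count :: "real set \<Rightarrow> 'a \<Rightarrow> ennreal" where
  "count A x = (\<Sum>k. arrived k x * indicator A (pos k x))"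

definition \<mu>T :: "real measure" where
  "\<mu>T = density \<mu> (indicator {..<T})"

lemma pos_borel [measurable]: "pos k \<in> borel_measurable P"
  unfolding pos_def by measurable

lemma arrived_borel [measurable]: "arrived k \<in> borel_measurable P"
  unfolding arrived_def by measurable

lemma sets_\<mu>T [measurable_cong]: "sets \<mu>T = sets borel"
  by (simp add: \<mu>T_def sets_\<mu>)

lemma emeasure_\<mu>T: "A \<in> sets borel \<Longrightarrow> emeasure \<mu>T A = emeasure \<mu> (A \<inter> {..<T})"
  unfolding \<mu>T_def by (subst emeasure_restricted) (auto simp: sets_\<mu> Int_commute)

lemma finite_\<mu>T: "finite_measure \<mu>T"
proof
  have "space \<mu>T = UNIV"
    using sets_eq_imp_space_eq[OF sets_\<mu>T] by simp
  then show "emeasure \<mu>T (space \<mu>T) \<noteq> \<infinity>"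
    using finite_\<mu> by (simp add: emeasure_\<mu>T)
qed

lemma count_borel [measurable]:
  assumes [measurable]: "A \<in> sets borel"
  shows "count A \<in> borel_measurable P"
  unfolding count_def by measurable

lemma count_eq_num_arrivals: "count A x = num_arrivals \<Gamma> (A \<inter> {..<T}) x"
  unfolding count_def num_arrivals_eq_suminf arrived_def pos_def
  by (intro suminf_cong) (auto split: split_indicator)

lemma prob_count:
  assumes "A \<in> sets borel"
  shows "prob {x \<in> space P. count A x = of_nat n}
    = measure \<mu>T A ^ n / fact n * exp (- measure \<mu>T A)"
proof -
  have "emeasure \<mu> (A \<inter> {..<T}) \<le> emeasure \<mu> {..<T}"
    using sets_\<mu> by (intro emeasure_mono) auto
  then have "emeasure \<mu> (A \<inter> {..<T}) < \<infinity>"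
    using finite_\<mu> by (rule le_less_trans)
  then show ?thesis
    using poisson assms unfolding poisson_process_def count_eq_num_arrivals
    by (simp add: measure_def emeasure_\<mu>T)
qed

lemma AE_count_finite: "A \<in> sets borel \<Longrightarrow> AE x in P. count A x < \<infinity>"
  by (rule nn_integral_poisson(1)[OF _ borel_measurable_const _ prob_count]) auto

lemma nn_integral_count:
  assumes [measurable]: "A \<in> sets borel"
  shows "(\<integral>\<^sup>+x. count A x \<partial>P) = emeasure \<mu>T A"
    and "(\<integral>\<^sup>+x. count A x * count A x \<partial>P) = emeasure \<mu>T A + emeasure \<mu>T A * emeasure \<mu>T A"
proof -
  interpret \<mu>T: finite_measure \<mu>T by (rule finite_\<mu>T)
  let ?m = "measure \<mu>T A"
  note p = nn_integral_poisson(2)[OF count_borel[OF assms] _ measure_nonneg prob_count[OF assms]]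
  have "(\<integral>\<^sup>+x. count A x \<partial>P) = ennreal ?m"
    using p[of "\<lambda>y. y", unfolded suminf_poisson_moments(2)[OF measure_nonneg]] by simp
  then show "(\<integral>\<^sup>+x. count A x \<partial>P) = emeasure \<mu>T A"
    by (simp add: \<mu>T.emeasure_eq_measure)
  have "(\<integral>\<^sup>+x. count A x * count A x \<partial>P) = ennreal (?m + ?m\<^sup>2)"
    using p[of "\<lambda>y. y * y", unfolded suminf_poisson_moments(3)[OF measure_nonneg]] by simp
  then show "(\<integral>\<^sup>+x. count A x * count A x \<partial>P) = emeasure \<mu>T A + emeasure \<mu>T A * emeasure \<mu>T A"
    by (simp add: \<mu>T.emeasure_eq_measure power2_eq_square ennreal_mult)
qed

lemma nn_integral_count_disjoint:
  assumes [measurable]: "A \<in> sets borel" "B \<in> sets borel" and "A \<inter> B = {}"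
  shows "(\<integral>\<^sup>+x. count A x * count B x \<partial>P) = emeasure \<mu>T A * emeasure \<mu>T B"
proof -
  \<comment> \<open>\<open>poisson_process\<close> grants independence only for sets of finite
    intensity, hence the intersection with \<open>{..<T}\<close>; the indices 0 and 1 carry the two
    sets.\<close>
  define D where "D = (\<lambda>i::nat. (if i = 0 then A else B) \<inter> {..<T})"
  have fin: "emeasure \<mu> (D i) < \<infinity>" for i
    using sets_\<mu> by (intro le_less_trans[OF emeasure_mono finite_\<mu>]) (auto simp: D_def)
  have "disjoint_family_on D {..<2}"
    using assms(3) by (auto simp: disjoint_family_on_def D_def less_2_cases_iff)
  moreover have "\<forall>i<2. D i \<in> sets borel \<and> emeasure \<mu> (D i) < \<infinity>"
    using fin by (auto simp: D_def)
  ultimately have "indep_vars (\<lambda>_. borel) (\<lambda>i. num_arrivals \<Gamma> (D i)) {..<2}"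
    using poisson unfolding poisson_process_def by blast
  from indep_vars_nn_integral[OF _ this]
  have "(\<integral>\<^sup>+x. num_arrivals \<Gamma> (D 0) x * num_arrivals \<Gamma> (D 1) x \<partial>P)
      = (\<integral>\<^sup>+x. num_arrivals \<Gamma> (D 0) x \<partial>P) * (\<integral>\<^sup>+x. num_arrivals \<Gamma> (D 1) x \<partial>P)"
    by (simp add: numeral_2_eq_2 lessThan_Suc mult.commute)
  moreover have "num_arrivals \<Gamma> (D 0) = count A" "num_arrivals \<Gamma> (D 1) = count B"
    by (auto simp: D_def count_eq_num_arrivals)
  ultimately show ?thesis
    by (simp add: nn_integral_count)
qed

lemma count_Un:
  assumes "A \<inter> B = {}"
  shows "count (A \<union> B) x = count A x + count B x"
  unfolding count_def using assms
  by (subst suminf_add) (auto intro!: suminf_cong split: split_indicator)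

text \<open>Split both sets along their intersection. Disjoint pieces are independent and multiply;
  the common piece contributes its Poisson second moment, whose excess over the square of the mean
  is the extra term.\<close>

lemma nn_integral_count_mult:
  assumes [measurable]: "A \<in> sets borel" "B \<in> sets borel"
  shows "(\<integral>\<^sup>+x. count A x * count B x \<partial>P) = emeasure \<mu>T A * emeasure \<mu>T B + emeasure \<mu>T (A \<inter> B)"
proof -
  let ?a = "A - B" and ?b = "B - A" and ?c = "A \<inter> B"
  have A: "A = ?a \<union> ?c" and B: "B = ?b \<union> ?c" by auto
  have cA: "count A x = count ?a x + count ?c x" for x
  proof -
    have "count (?a \<union> ?c) x = count ?a x + count ?c x" by (rule count_Un) auto
    then show ?thesis by (simp only: A[symmetric])
  qed
  have cB: "count B x = count ?b x + count ?c x" for x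
  proof -
    have "count (?b \<union> ?c) x = count ?b x + count ?c x" by (rule count_Un) auto
    then show ?thesis by (simp only: B[symmetric])
  qed
  have "(\<integral>\<^sup>+x. count A x * count B x \<partial>P)
      = (\<integral>\<^sup>+x. (count ?a x + count ?c x) * (count ?b x + count ?c x) \<partial>P)"
    by (simp only: cA cB)
  also have "\<dots> = (\<integral>\<^sup>+x. count ?a x * count ?b x + count ?a x * count ?c x
      + count ?c x * count ?b x + count ?c x * count ?c x \<partial>P)"
    by (intro nn_integral_cong) (simp add: algebra_simps)
  also have "\<dots> = emeasure \<mu>T ?a * emeasure \<mu>T ?b + emeasure \<mu>T ?a * emeasure \<mu>T ?c
      + emeasure \<mu>T ?c * emeasure \<mu>T ?b + (emeasure \<mu>T ?c + emeasure \<mu>T ?c * emeasure \<mu>T ?c)"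
  proof -
    have "?a \<inter> ?b = {}" "?a \<inter> ?c = {}" "?c \<inter> ?b = {}" by auto
    then show ?thesis
      by (simp add: nn_integral_add nn_integral_count nn_integral_count_disjoint)
  qed
  also have "\<dots> = (emeasure \<mu>T ?a + emeasure \<mu>T ?c) * (emeasure \<mu>T ?b + emeasure \<mu>T ?c) + emeasure \<mu>T ?c"
    by (simp add: algebra_simps)
  also have "emeasure \<mu>T ?a + emeasure \<mu>T ?c = emeasure \<mu>T A"
  proof -
    have "emeasure \<mu>T ?a + emeasure \<mu>T ?c = emeasure \<mu>T (?a \<union> ?c)"
      by (rule plus_emeasure) auto
    then show ?thesis by (simp only: A[symmetric])
  qed
  also have "emeasure \<mu>T ?b + emeasure \<mu>T ?c = emeasure \<mu>T B"
  proof -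
    have "emeasure \<mu>T ?b + emeasure \<mu>T ?c = emeasure \<mu>T (?b \<union> ?c)"
      by (rule plus_emeasure) auto
    then show ?thesis by (simp only: B[symmetric])
  qed
  finally show ?thesis .
qed

text \<open>The sum over labels is essential: as no ordering is imposed, the law of a single
  \<open>pos k\<close> is not determined, but the superposition of these laws is the
  intensity.\<close>

lemma campbell:
  assumes "f \<in> borel_measurable borel"
  shows "(\<Sum>k. \<integral>\<^sup>+x. arrived k x * f (pos k x) \<partial>P) = (\<integral>\<^sup>+s. f s \<partial>\<mu>T)"
proof -
  have "(\<Sum>k. \<integral>\<^sup>+x. arrived k x * f (pos k x) \<partial>P) = 1 * (\<integral>\<^sup>+s. f s \<partial>\<mu>T)"
  proof (rule suminf_nn_integral_transfer)
    fix A assume "A \<in> sets \<mu>T"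
    then have [measurable]: "A \<in> sets borel" by (simp add: sets_\<mu>T)
    have "(\<Sum>k. \<integral>\<^sup>+x. arrived k x * indicator A (pos k x) \<partial>P) = (\<integral>\<^sup>+x. count A x \<partial>P)"
      unfolding count_def by (rule nn_integral_suminf[symmetric]) measurable
    then show "(\<Sum>k. \<integral>\<^sup>+x. arrived k x * indicator A (pos k x) \<partial>P) = 1 * emeasure \<mu>T A"
      by (simp add: nn_integral_count)
  qed (use assms in measurable)
  then show ?thesis by simp
qed

text \<open>
  Indicators first: the off-diagonal count of a rectangle is the product of the counts minus the
  count of the diagonal. The two coordinates are then generalised one after the other.
\<close>

lemma campbell_off_diagonal:
  assumes f[measurable]: "f \<in> borel_measurable borel" and g[measurable]: "g \<in> borel_measurable borel"
  shows "(\<Sum>k. \<Sum>j. of_bool (k \<noteq> j) * (\<integral>\<^sup>+x. arrived k x * f (pos k x) * (arrived j x * g (pos j x)) \<partial>P))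
    = (\<integral>\<^sup>+s. f s \<partial>\<mu>T) * (\<integral>\<^sup>+s. g s \<partial>\<mu>T)"
proof -
  interpret \<mu>T: finite_measure \<mu>T by (rule finite_\<mu>T)
  let ?w = "\<lambda>f k x. arrived k x * f (pos k x)"
  have indicators: "(\<Sum>k. \<Sum>j. \<integral>\<^sup>+x. of_bool (k \<noteq> j) * (?w (indicator A) k x * ?w (indicator B) j x) \<partial>P)
      = emeasure \<mu>T A * emeasure \<mu>T B"
    if [measurable]: "A \<in> sets borel" "B \<in> sets borel" for A B
  proof -
    let ?S = "(\<Sum>k. \<Sum>j. \<integral>\<^sup>+x. of_bool (k \<noteq> j) * (?w (indicator A) k x * ?w (indicator B) j x) \<partial>P)"
    have "(\<Sum>j. \<integral>\<^sup>+x. of_bool (k \<noteq> j) * (?w (indicator A) k x * ?w (indicator B) j x) \<partial>P)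
        = (\<integral>\<^sup>+x. (\<Sum>j. of_bool (k \<noteq> j) * (?w (indicator A) k x * ?w (indicator B) j x)) \<partial>P)" for k
      by (rule nn_integral_suminf[symmetric]) measurable
    then have "?S = (\<Sum>k. \<integral>\<^sup>+x. (\<Sum>j. of_bool (k \<noteq> j) * (?w (indicator A) k x * ?w (indicator B) j x)) \<partial>P)"
      by (simp only:)
    also have "\<dots> = (\<integral>\<^sup>+x. (\<Sum>k. \<Sum>j. of_bool (k \<noteq> j) * (?w (indicator A) k x * ?w (indicator B) j x)) \<partial>P)"
      by (rule nn_integral_suminf[symmetric]) measurable
    finally have S: "?S = \<dots>" .
    have AB: "emeasure \<mu>T (A \<inter> B) = (\<integral>\<^sup>+x. (\<Sum>k. ?w (indicator A) k x * ?w (indicator B) k x) \<partial>P)"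
      unfolding nn_integral_count[OF sets.Int[OF that], symmetric] count_def
      by (intro nn_integral_cong suminf_cong) (auto simp: arrived_def split: split_indicator)
    have "?S + emeasure \<mu>T (A \<inter> B) = (\<integral>\<^sup>+x. count A x * count B x \<partial>P)"
      unfolding S AB count_def suminf_off_diagonal
      by (rule nn_integral_add[symmetric]) measurable
    \<comment> \<open>The diagonal has finite mass under \<open>\<mu>T\<close>, so it may be
      cancelled from both sides.\<close>
    then have "emeasure \<mu>T (A \<inter> B) + ?S = emeasure \<mu>T (A \<inter> B) + emeasure \<mu>T A * emeasure \<mu>T B"
      unfolding nn_integral_count_mult[OF that] by (simp only: add.commute)
    then show ?thesis
      unfolding ennreal_add_left_cancel using \<mu>T.emeasure_finite[of "A \<inter> B"] by simp
  qed
  have first: "(\<Sum>k. \<Sum>j. \<integral>\<^sup>+x. of_bool (k \<noteq> j) * (?w f k x * ?w (indicator B) j x) \<partial>P)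
      = (\<integral>\<^sup>+s. f s \<partial>\<mu>T) * emeasure \<mu>T B"
    if [measurable]: "B \<in> sets borel" for B
  proof -
    \<comment> \<open>All points with label other than \<open>k\<close> that fall in
      \<open>B\<close> are frozen into the weight of label \<open>k\<close>; the transfer lemma then
      acts on the position of \<open>k\<close> alone.\<close>
    let ?W = "\<lambda>k x. arrived k x * (\<Sum>j. of_bool (k \<noteq> j) * ?w (indicator B) j x)"
    have W: "(\<integral>\<^sup>+x. ?W k x * h (pos k x) \<partial>P)
        = (\<Sum>j. \<integral>\<^sup>+x. of_bool (k \<noteq> j) * (?w h k x * ?w (indicator B) j x) \<partial>P)"
      if [measurable]: "h \<in> borel_measurable borel" for h k
    proof -
      have "(\<Sum>j. of_bool (k \<noteq> j) * (?w h k x * ?w (indicator B) j x))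
          = ?w h k x * (\<Sum>j. of_bool (k \<noteq> j) * ?w (indicator B) j x)" for x
        unfolding mult.left_commute[of "of_bool _"] by (rule ennreal_suminf_cmult)
      then have "(\<Sum>j. of_bool (k \<noteq> j) * (?w h k x * ?w (indicator B) j x)) = ?W k x * h (pos k x)" for x
        by (simp add: mult_ac)
      moreover have "(\<Sum>j. \<integral>\<^sup>+x. of_bool (k \<noteq> j) * (?w h k x * ?w (indicator B) j x) \<partial>P)
          = (\<integral>\<^sup>+x. (\<Sum>j. of_bool (k \<noteq> j) * (?w h k x * ?w (indicator B) j x)) \<partial>P)"
        by (rule nn_integral_suminf[symmetric]) measurable
      ultimately show ?thesis by simp
    qed
    have "(\<Sum>k. \<integral>\<^sup>+x. ?W k x * f (pos k x) \<partial>P) = emeasure \<mu>T B * (\<integral>\<^sup>+s. f s \<partial>\<mu>T)"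
    proof (rule suminf_nn_integral_transfer)
      fix A assume "A \<in> sets \<mu>T"
      then have [measurable]: "A \<in> sets borel" by (simp add: sets_\<mu>T)
      show "(\<Sum>k. \<integral>\<^sup>+x. ?W k x * indicator A (pos k x) \<partial>P) = emeasure \<mu>T B * emeasure \<mu>T A"
        by (subst W) (auto simp: indicators mult.commute)
    qed measurable
    then show ?thesis
      unfolding W[OF f] by (simp only: mult.commute)
  qed
  \<comment> \<open>Now the first coordinate, already carrying a general \<open>f\<close>, is
    frozen. The transfer lemma needs the outer sum over the label whose function varies, which is
    why the order of summation is swapped before and after.\<close>
  let ?W = "\<lambda>j x. arrived j x * (\<Sum>k. of_bool (k \<noteq> j) * ?w f k x)"
  have W: "(\<integral>\<^sup>+x. ?W j x * h (pos j x) \<partial>P)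
      = (\<Sum>k. \<integral>\<^sup>+x. of_bool (k \<noteq> j) * (?w f k x * ?w h j x) \<partial>P)"
    if [measurable]: "h \<in> borel_measurable borel" for h j
  proof -
    have "(\<Sum>k. of_bool (k \<noteq> j) * (?w f k x * ?w h j x))
        = ?w h j x * (\<Sum>k. of_bool (k \<noteq> j) * ?w f k x)" for x
      unfolding ennreal_suminf_cmult[symmetric] by (rule suminf_cong) (simp only: mult_ac)
    then have "(\<Sum>k. of_bool (k \<noteq> j) * (?w f k x * ?w h j x)) = ?W j x * h (pos j x)" for x
      by (simp add: mult_ac)
    moreover have "(\<Sum>k. \<integral>\<^sup>+x. of_bool (k \<noteq> j) * (?w f k x * ?w h j x) \<partial>P)
        = (\<integral>\<^sup>+x. (\<Sum>k. of_bool (k \<noteq> j) * (?w f k x * ?w h j x)) \<partial>P)"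
      by (rule nn_integral_suminf[symmetric]) measurable
    ultimately show ?thesis by simp
  qed
  have "(\<Sum>j. \<integral>\<^sup>+x. ?W j x * g (pos j x) \<partial>P) = (\<integral>\<^sup>+s. f s \<partial>\<mu>T) * (\<integral>\<^sup>+s. g s \<partial>\<mu>T)"
  proof (rule suminf_nn_integral_transfer)
    fix B assume "B \<in> sets \<mu>T"
    then have B[measurable]: "B \<in> sets borel" by (simp add: sets_\<mu>T)
    show "(\<Sum>j. \<integral>\<^sup>+x. ?W j x * indicator B (pos j x) \<partial>P) = (\<integral>\<^sup>+s. f s \<partial>\<mu>T) * emeasure \<mu>T B"
      unfolding first[OF B, symmetric] W[OF borel_measurable_indicator[OF B]]
      by (rule suminf_swap_ennreal)
  qed measurable
  also have "(\<Sum>j. \<integral>\<^sup>+x. ?W j x * g (pos j x) \<partial>P)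
      = (\<Sum>k. \<Sum>j. \<integral>\<^sup>+x. of_bool (k \<noteq> j) * (?w f k x * ?w g j x) \<partial>P)"
    unfolding W[OF g] by (rule suminf_swap_ennreal)
  finally have "(\<Sum>k. \<Sum>j. \<integral>\<^sup>+x. of_bool (k \<noteq> j) * (?w f k x * ?w g j x) \<partial>P)
      = (\<integral>\<^sup>+s. f s \<partial>\<mu>T) * (\<integral>\<^sup>+s. g s \<partial>\<mu>T)" .
  moreover have "(\<integral>\<^sup>+x. of_bool (k \<noteq> j) * (?w f k x * ?w g j x) \<partial>P)
      = of_bool (k \<noteq> j) * (\<integral>\<^sup>+x. ?w f k x * ?w g j x \<partial>P)" for k j
    by (rule nn_integral_cmult) measurable
  ultimately show ?thesis by (simp only:)
qed

end

section \<open>Independent marks\<close>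

text \<open>Finite measures on the plane that agree on rectangles coincide. The weights
  \<open>U\<close> and \<open>W\<close> may differ: with two jobs, the other mark is still random in
  \<open>U\<close> but already averaged in \<open>W\<close>.\<close>

lemma nn_integral_disintegrate:
  fixes X Y :: "'a \<Rightarrow> real" and U W :: "'a \<Rightarrow> ennreal" and \<kappa> :: "real \<Rightarrow> real measure"
  assumes [measurable]: "X \<in> borel_measurable P" "Y \<in> borel_measurable P"
      "U \<in> borel_measurable P" "W \<in> borel_measurable P"
    and \<kappa>[measurable]: "\<kappa> \<in> borel \<rightarrow>\<^sub>M prob_algebra borel"
    and fin: "(\<integral>\<^sup>+x. U x \<partial>P) < \<infinity>"
    and rect: "\<And>A B. A \<in> sets borel \<Longrightarrow> B \<in> sets borel \<Longrightarrow>
      (\<integral>\<^sup>+x. U x * (indicator A (X x) * indicator B (Y x)) \<partial>P)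
      = (\<integral>\<^sup>+x. W x * (indicator A (X x) * emeasure (\<kappa> (X x)) B) \<partial>P)"
    and E: "E \<in> sets (borel \<Otimes>\<^sub>M borel)"
    and "space P \<noteq> {}"
  shows "(\<integral>\<^sup>+x. U x * indicator E (X x, Y x) \<partial>P)
    = (\<integral>\<^sup>+x. W x * emeasure (\<kappa> (X x)) {r. (X x, r) \<in> E} \<partial>P)"
proof -
  let ?S = "borel \<Otimes>\<^sub>M borel :: (real \<times> real) measure"
  \<comment> \<open>\<open>m1\<close> is the \<open>U\<close>-weighted law of the actual pair;
    \<open>m2\<close> takes \<open>X\<close> under the weight \<open>W\<close> and draws the second
    coordinate from the kernel.\<close>
  define m1 where "m1 = distr (density P U) ?S (\<lambda>x. (X x, Y x))"
  define \<theta> where "\<theta> = (\<lambda>x. distr (\<kappa> (X x)) ?S (Pair (X x)))"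
  define m2 where "m2 = density P W \<bind> \<theta>"
  note [measurable] = measurable_prob_algebraD[OF \<kappa>]
  have \<theta>[measurable]: "\<theta> \<in> density P W \<rightarrow>\<^sub>M subprob_algebra ?S"
    unfolding \<theta>_def by (rule measurable_distr2[where M=borel]) measurable
  have sets\<kappa>: "sets (\<kappa> s) = sets borel" for s
    using measurable_space[OF \<kappa>, of s] by (auto simp: space_prob_algebra)
  have e1: "emeasure m1 E = (\<integral>\<^sup>+x. U x * indicator E (X x, Y x) \<partial>P)" if "E \<in> sets ?S" for E
    using that unfolding m1_def
    by (subst emeasure_distr, measurable, subst emeasure_density, measurable)
       (auto intro!: nn_integral_cong split: split_indicator)
  have e2: "emeasure m2 E = (\<integral>\<^sup>+x. W x * emeasure (\<kappa> (X x)) {r. (X x, r) \<in> E} \<partial>P)"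
    if E: "E \<in> sets ?S" for E
  proof -
    have \<theta>E: "emeasure (\<theta> x) E = emeasure (\<kappa> (X x)) {r. (X x, r) \<in> E}" for x
    proof -
      have "Pair (X x) \<in> \<kappa> (X x) \<rightarrow>\<^sub>M ?S"
        unfolding measurable_cong_sets[OF sets\<kappa> refl] by measurable
      moreover have "Pair (X x) -` E \<inter> space (\<kappa> (X x)) = {r. (X x, r) \<in> E}"
        using sets_eq_imp_space_eq[OF sets\<kappa>] by auto
      ultimately show ?thesis
        unfolding \<theta>_def using E by (simp add: emeasure_distr)
    qed
    have "emeasure m2 E = (\<integral>\<^sup>+x. emeasure (\<theta> x) E \<partial>density P W)"
      unfolding m2_def using \<open>space P \<noteq> {}\<close> \<theta> E by (subst emeasure_bind) auto
    also have "\<dots> = (\<integral>\<^sup>+x. W x * emeasure (\<theta> x) E \<partial>P)"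
      using measurable_compose[OF \<theta> measurable_emeasure_subprob_algebra[OF E]]
      by (subst nn_integral_density) auto
    finally show ?thesis unfolding \<theta>E .
  qed
  have "m1 = m2"
  proof (rule measure_eqI_generator_eq[where \<Omega>=UNIV and A="\<lambda>_. UNIV"
        and E="{A \<times> B | A B. A \<in> sets borel \<and> B \<in> sets borel}"])
    show "Int_stable {A \<times> B | A B. A \<in> sets (borel :: real measure) \<and> B \<in> sets (borel :: real measure)}"
      using Int_stable_pair_measure_generator[of "borel :: real measure" "borel :: real measure"] by simp
    show s1: "sets m1 = sigma_sets UNIV {A \<times> B | A B. A \<in> sets borel \<and> B \<in> sets borel}"
      unfolding m1_def by (simp add: sets_pair_measure)
    show "sets m2 = sigma_sets UNIV {A \<times> B | A B. A \<in> sets borel \<and> B \<in> sets borel}"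
      unfolding m2_def using \<open>space P \<noteq> {}\<close>
      by (subst sets_bind[where N="?S"]) (auto simp: sets_pair_measure \<theta>_def)
    show "emeasure m1 R = emeasure m2 R"
      if "R \<in> {A \<times> B | A B. A \<in> sets borel \<and> B \<in> sets borel}" for R
    proof -
      from that obtain A B where R: "R = A \<times> B" and [measurable]: "A \<in> sets borel" "B \<in> sets borel"
        by auto
      have "{r. (X x, r) \<in> R} = (if X x \<in> A then B else {})" for x
        by (auto simp: R)
      moreover have "R \<in> sets ?S" unfolding R by measurable
      moreover have "indicator R (X x, Y x) = (indicator A (X x) * indicator B (Y x) :: ennreal)" for x
        by (auto simp: R split: split_indicator)
      moreover have "indicator A (X x) * emeasure (\<kappa> (X x)) B
          = emeasure (\<kappa> (X x)) (if X x \<in> A then B else {})" for x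
        by auto
      ultimately show ?thesis
        using rect[of A B] by (simp add: e1 e2)
    qed
    show "emeasure m1 UNIV \<noteq> \<infinity>" for i :: nat
    proof -
      have "UNIV \<in> sets ?S"
        using sets.top[of ?S] by (simp add: space_pair_measure)
      then show ?thesis
        using fin by (subst e1) auto
    qed
  qed (auto intro!: exI[of _ "UNIV :: real set"])
  then show ?thesis
    using e1[OF E] e2[OF E] by simp
qed

lemma (in prob_space) nn_integral_le_1_finite:
  assumes "\<And>x. f x \<le> 1"
  shows "(\<integral>\<^sup>+x. f x \<partial>M) < \<infinity>"
proof -
  have "(\<integral>\<^sup>+x. f x \<partial>M) \<le> (\<integral>\<^sup>+x. 1 \<partial>M)"
    using assms by (intro nn_integral_mono) auto
  then show ?thesis
    by (simp add: emeasure_space_1 ennreal_one_less_top order_le_less_trans)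
qed

text \<open>A measurable kernel must be given on the whole line, whereas the service laws will be
  controlled at nonnegative times only. So \<open>\<kappa>\<close> is a parameter that agrees with
  them at positive times, and \<open>no_initial\<close> keeps arrivals away from 0.\<close>

locale marked_arrivals = poisson_arrivals P \<Gamma> \<mu> T
  for P :: "'a measure" and \<Gamma> :: "nat \<Rightarrow> 'a \<Rightarrow> ennreal" and \<mu> :: "real measure" and T :: real +
  fixes L :: "nat \<Rightarrow> 'a \<Rightarrow> real" and ell :: "real \<Rightarrow> real \<Rightarrow> real" and \<kappa> :: "real \<Rightarrow> real measure"
  assumes L_borel [measurable]: "\<And>k. L k \<in> borel_measurable P"
    and T_pos: "T > 0"
    and no_initial: "emeasure \<mu> {..0} = 0"
    and marks: "service_times P ell \<Gamma> L"
    and \<kappa>_kernel [measurable]: "\<kappa> \<in> borel \<rightarrow>\<^sub>M prob_algebra borel"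
    and \<kappa>_eq: "\<And>s. s > 0 \<Longrightarrow> \<kappa> s = service_law ell s"
begin

lemma prob_\<kappa>: "prob_space (\<kappa> s)"
  using measurable_space[OF \<kappa>_kernel, of s] by (auto simp: space_prob_algebra)

lemma emeasure_\<kappa>_borel: "Sigma UNIV B \<in> sets (borel \<Otimes>\<^sub>M borel) \<Longrightarrow>
    (\<lambda>s. emeasure (\<kappa> s) (B s)) \<in> borel_measurable borel"
  using measurable_prob_algebraD[OF \<kappa>_kernel] by (intro emeasure_measurable_subprob_algebra2) auto

text \<open>The expected number of arrivals at 0 is the intensity of that point, which is 0. This
  makes \<open>\<kappa>_eq\<close> applicable at every arrival before \<open>T\<close>.\<close>

lemma AE_pos: "AE x in P. \<forall>k. arrived k x \<noteq> 0 \<longrightarrow> pos k x > 0"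
proof -
  have "emeasure \<mu>T {0} \<le> emeasure \<mu> {..0}"
    by (subst emeasure_\<mu>T) (auto simp: sets_\<mu> intro: emeasure_mono)
  then have "(\<integral>\<^sup>+x. count {0} x \<partial>P) = 0"
    unfolding no_initial by (subst nn_integral_count) auto
  then have "AE x in P. count {0} x = 0"
    by (subst (asm) nn_integral_0_iff_AE) auto
  then show ?thesis
  proof eventually_elim
    case (elim x)
    then have "arrived k x * indicator {0} (pos k x) = 0" for k
      unfolding count_def by (subst (asm) suminf_eq_zero_iff) auto
    then have "arrived k x \<noteq> 0 \<longrightarrow> pos k x \<noteq> 0" for k
      by (auto simp: indicator_def split: if_splits)
    moreover have "pos k x \<ge> 0" for k
      by (simp add: pos_def)
    ultimately show ?case
      by (simp add: order.strict_iff_order)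
  qed
qed

lemma
  shows subalgebra_\<Gamma>: "subalgebra P (sigma_rvs P UNIV \<Gamma>)"
    and \<Gamma>_measurable_sigma_rvs: "\<Gamma> k \<in> borel_measurable (sigma_rvs P UNIV \<Gamma>)"
proof -
  let ?G = "\<Union>i. {\<Gamma> i -` B \<inter> space P | B. B \<in> sets borel}"
  have G: "?G \<subseteq> sets P"
    using measurable_sets[OF \<Gamma>_borel] by auto
  have sets: "sets (sigma_rvs P UNIV \<Gamma>) = sigma_sets (space P) ?G"
    unfolding sigma_rvs_def using G sets.space_closed[of P] by (intro sets_measure_of) auto
  have space: "space (sigma_rvs P UNIV \<Gamma>) = space P"
    unfolding sigma_rvs_def by (simp add: space_measure_of_conv)
  show "subalgebra P (sigma_rvs P UNIV \<Gamma>)"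
    unfolding subalgebra_def space sets using sets.sigma_sets_subset[OF G] by simp
  show "\<Gamma> k \<in> borel_measurable (sigma_rvs P UNIV \<Gamma>)"
    by (rule measurableI) (auto simp: space sets intro!: sigma_sets.Basic)
qed

text \<open>
  \<^const>\<open>service_times\<close> only speaks about fixed Borel sets of service times; this is the rectangle
  case from which the event \<open>T < pos k x + L k x\<close> is reached by disintegration.
\<close>

lemma nn_integral_marks:
  assumes "finite J" and A: "\<And>k. k \<in> J \<Longrightarrow> A k \<in> sets borel" and B: "\<And>k. k \<in> J \<Longrightarrow> B k \<in> sets borel"
  shows "(\<integral>\<^sup>+x. (\<Prod>k\<in>J. arrived k x * (indicator (A k) (pos k x) * indicator (B k) (L k x))) \<partial>P)
    = (\<integral>\<^sup>+x. (\<Prod>k\<in>J. arrived k x * (indicator (A k) (pos k x) * emeasure (\<kappa> (pos k x)) (B k))) \<partial>P)"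
proof -
  let ?F = "sigma_rvs P UNIV \<Gamma>"
  interpret F: finite_measure_subalgebra P ?F
    by standard (rule subalgebra_\<Gamma>)
  note [measurable] = \<Gamma>_measurable_sigma_rvs
  \<comment> \<open>\<open>G\<close> collects the conditions on arrival times and lies in the
    sigma-algebra they generate; \<open>H\<close> collects those on services. Integrating the
    indicator of \<open>H\<close> over \<open>G\<close> therefore equals integrating its conditional
    expectation, which on \<open>G\<close> is the product of kernel masses.\<close>
  define G where "G = {x \<in> space P. \<forall>k\<in>J. \<Gamma> k x < \<infinity> \<and> pos k x < T \<and> pos k x \<in> A k}"
  define H where "H = {x \<in> space P. \<forall>k\<in>J. \<Gamma> k x < \<infinity> \<and> L k x \<in> B k}"
  have spaceF: "space ?F = space P"
    using subalgebra_\<Gamma> by (simp add: subalgebra_def)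
  have "{x \<in> space ?F. \<forall>k\<in>J. \<Gamma> k x < \<infinity> \<and> enn2real (\<Gamma> k x) < T \<and> enn2real (\<Gamma> k x) \<in> A k} \<in> sets ?F"
  proof (rule sets.sets_Collect_finite_All[OF _ \<open>finite J\<close>])
    fix k assume "k \<in> J"
    note [measurable] = A[OF this]
    show "{x \<in> space ?F. \<Gamma> k x < \<infinity> \<and> enn2real (\<Gamma> k x) < T \<and> enn2real (\<Gamma> k x) \<in> A k} \<in> sets ?F"
      by measurable
  qed
  then have GF: "G \<in> sets ?F"
    unfolding G_def pos_def spaceF .
  then have [measurable]: "G \<in> sets P"
    using subalgebra_\<Gamma> by (auto simp: subalgebra_def)
  have [measurable]: "H \<in> sets P"
    unfolding H_def
  proof (rule sets.sets_Collect_finite_All[OF _ \<open>finite J\<close>])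
    fix k assume "k \<in> J"
    note [measurable] = B[OF this]
    show "{x \<in> space P. \<Gamma> k x < \<infinity> \<and> L k x \<in> B k} \<in> sets P"
      by measurable
  qed
  let ?p = "\<lambda>x. \<Prod>k\<in>J. of_bool (\<Gamma> k x < \<infinity>) * measure (service_law ell (enn2real (\<Gamma> k x))) (B k)"
  have AEp: "AE x in P. real_cond_exp P ?F (indicator H) x = ?p x"
    using marks B \<open>finite J\<close> unfolding service_times_def H_def by blast
  have lhs: "(\<Prod>k\<in>J. arrived k x * (indicator (A k) (pos k x) * indicator (B k) (L k x)))
      = indicator (G \<inter> H) x" if "x \<in> space P" for x
  proof (cases "x \<in> G \<inter> H")
    case True
    then show ?thesis
      by (auto simp: G_def H_def arrived_def intro!: prod.neutral)
  next
    case False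
    then show ?thesis
      using that \<open>finite J\<close>
      by (auto simp: G_def H_def arrived_def prod_zero_iff split: split_indicator)
  qed
  have rhs: "AE x in P. (\<Prod>k\<in>J. arrived k x * (indicator (A k) (pos k x) * emeasure (\<kappa> (pos k x)) (B k)))
      = ennreal (indicator G x * real_cond_exp P ?F (indicator H) x)"
    using AEp AE_pos AE_space
  proof eventually_elim
    case (elim x)
    show ?case
    proof (cases "x \<in> G")
      case True
      have "arrived k x * (indicator (A k) (pos k x) * emeasure (\<kappa> (pos k x)) (B k))
          = ennreal (of_bool (\<Gamma> k x < \<infinity>) * measure (service_law ell (enn2real (\<Gamma> k x))) (B k))"
        if "k \<in> J" for k
      proof -
        have "arrived k x = 1" "pos k x \<in> A k" "\<Gamma> k x < \<infinity>"
          using True that by (auto simp: G_def arrived_def)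
        moreover from this have "\<kappa> (pos k x) = service_law ell (pos k x)"
          using elim(2) by (auto intro!: \<kappa>_eq)
        moreover have "emeasure (\<kappa> (pos k x)) (B k) = measure (\<kappa> (pos k x)) (B k)"
          using prob_space.axioms(1)[OF prob_\<kappa>] by (rule finite_measure.emeasure_eq_measure)
        ultimately show ?thesis by (simp add: pos_def)
      qed
      then have "(\<Prod>k\<in>J. arrived k x * (indicator (A k) (pos k x) * emeasure (\<kappa> (pos k x)) (B k)))
          = (\<Prod>k\<in>J. ennreal (of_bool (\<Gamma> k x < \<infinity>) * measure (service_law ell (enn2real (\<Gamma> k x))) (B k)))"
        by (rule prod.cong[OF refl])
      then show ?thesis
        using True elim(1) by (simp add: prod_ennreal)
    next
      case False
      then show ?thesis
        using elim(3) \<open>finite J\<close> by (auto simp: G_def arrived_def prod_zero_iff split: split_indicator)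
    qed
  qed
  have int: "integrable P (real_cond_exp P ?F (indicator H))"
    by (intro F.real_cond_exp_int integrable_real_indicator) (auto simp: emeasure_eq_measure)
  have nonneg: "AE x in P. 0 \<le> indicator G x * real_cond_exp P ?F (indicator H) x"
    using AEp by eventually_elim (auto intro!: mult_nonneg_nonneg prod_nonneg)
  have "(\<integral>\<^sup>+x. (\<Prod>k\<in>J. arrived k x * (indicator (A k) (pos k x) * indicator (B k) (L k x))) \<partial>P)
      = emeasure P (G \<inter> H)"
    by (subst nn_integral_cong[OF lhs]) auto
  also have "\<dots> = ennreal (\<integral>x\<in>G. indicator H x \<partial>P)"
    by (simp add: set_lebesgue_integral_def emeasure_eq_measure flip: indicator_inter_arith)
  also have "(\<integral>x\<in>G. indicator H x \<partial>P) = (\<integral>x\<in>G. real_cond_exp P ?F (indicator H) x \<partial>P)"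
    by (rule F.real_cond_exp_intA[OF _ GF]) (auto simp: emeasure_eq_measure)
  also have "ennreal \<dots> = (\<integral>\<^sup>+x. ennreal (indicator G x * real_cond_exp P ?F (indicator H) x) \<partial>P)"
    unfolding set_lebesgue_integral_def real_scaleR_def
    using integrable_mult_indicator[OF _ int, of G] nonneg by (intro nn_integral_eq_integral[symmetric]) auto
  also have "\<dots> = (\<integral>\<^sup>+x. (\<Prod>k\<in>J. arrived k x * (indicator (A k) (pos k x) * emeasure (\<kappa> (pos k x)) (B k))) \<partial>P)"
    using rhs by (intro nn_integral_cong_AE) auto
  finally show ?thesis .
qed

section \<open>Moments of the number of active jobs\<close>

text \<open>The pairs of arrival and service time for which the job outlives \<open>T\<close>. As a
  set in the plane, it has slices whose kernel mass is measurable in the arrival time.\<close>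

definition overshoot :: "(real \<times> real) set" where
  "overshoot = {(s, r). T < s + r}"

definition tail :: "real \<Rightarrow> ennreal" where
  "tail s = emeasure (\<kappa> s) {r. (s, r) \<in> overshoot}"

definition active :: "nat \<Rightarrow> 'a \<Rightarrow> ennreal" where
  "active k x = arrived k x * indicator overshoot (pos k x, L k x)"

lemma overshoot_sets [measurable]: "overshoot \<in> sets (borel \<Otimes>\<^sub>M borel)"
proof -
  have "overshoot = {p \<in> space (borel \<Otimes>\<^sub>M borel). T < fst p + snd p}"
    by (auto simp: overshoot_def space_pair_measure)
  then show ?thesis by simp
qed

lemma tail_borel [measurable]: "tail \<in> borel_measurable borel"
proof -
  have "Sigma UNIV (\<lambda>s. {r. (s, r) \<in> overshoot}) = overshoot" by auto
  then show ?thesis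
    unfolding tail_def by (intro emeasure_\<kappa>_borel) simp
qed

lemma active_borel [measurable]: "active k \<in> borel_measurable P"
  unfolding active_def by measurable

lemma arrived_le_1: "arrived k x \<le> 1"
  by (simp add: arrived_def)

lemma tail_le_1: "tail s \<le> 1"
  unfolding tail_def
  using subprob_space.subprob_emeasure_le_1[OF prob_space_imp_subprob_space[OF prob_\<kappa>]] .

lemma emeasure_\<kappa>_const_borel [measurable]:
  assumes "B \<in> sets borel"
  shows "(\<lambda>s. emeasure (\<kappa> s) B) \<in> borel_measurable borel"
  using measurable_compose[OF measurable_prob_algebraD[OF \<kappa>_kernel] measurable_emeasure_subprob_algebra[OF assms]] .

lemma nn_integral_active: "(\<integral>\<^sup>+x. active k x \<partial>P) = (\<integral>\<^sup>+x. arrived k x * tail (pos k x) \<partial>P)"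
  unfolding active_def tail_def
proof (rule nn_integral_disintegrate[where P=P])
  show "(\<integral>\<^sup>+x. arrived k x \<partial>P) < \<infinity>"
    by (intro nn_integral_le_1_finite arrived_le_1)
  show "(\<integral>\<^sup>+x. arrived k x * (indicator A (pos k x) * indicator B (L k x)) \<partial>P)
      = (\<integral>\<^sup>+x. arrived k x * (indicator A (pos k x) * emeasure (\<kappa> (pos k x)) B) \<partial>P)"
    if "A \<in> sets borel" "B \<in> sets borel" for A B
    using nn_integral_marks[of "{k}" "\<lambda>_. A" "\<lambda>_. B"] that by simp
qed (use not_empty in measurable)

text \<open>The marks are averaged one at a time. \<open>first\<close> averages the mark of
  \<open>k\<close> while that of \<open>j\<close> is still tested against a rectangle inside the
  weight; read as a statement about all such rectangles, it is exactly the hypothesis needed to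
  disintegrate the mark of \<open>j\<close>.\<close>

lemma nn_integral_active_pair:
  assumes "k \<noteq> j"
  shows "(\<integral>\<^sup>+x. active k x * active j x \<partial>P)
    = (\<integral>\<^sup>+x. arrived k x * tail (pos k x) * (arrived j x * tail (pos j x)) \<partial>P)"
proof -
  have first: "(\<integral>\<^sup>+x. arrived k x * (arrived j x * (indicator A' (pos j x) * indicator B' (L j x)))
        * indicator overshoot (pos k x, L k x) \<partial>P)
      = (\<integral>\<^sup>+x. arrived k x * (arrived j x * (indicator A' (pos j x) * emeasure (\<kappa> (pos j x)) B'))
        * tail (pos k x) \<partial>P)"
    if [measurable]: "A' \<in> sets borel" "B' \<in> sets borel" for A' B'
    unfolding tail_def
  proof (rule nn_integral_disintegrate[where P=P])
    show "(\<integral>\<^sup>+x. arrived k x * (arrived j x * (indicator A' (pos j x) * indicator B' (L j x))) \<partial>P) < \<infinity>"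
      by (intro nn_integral_le_1_finite) (auto simp: arrived_def split: split_indicator)
    show "(\<integral>\<^sup>+x. arrived k x * (arrived j x * (indicator A' (pos j x) * indicator B' (L j x)))
          * (indicator A (pos k x) * indicator B (L k x)) \<partial>P)
        = (\<integral>\<^sup>+x. arrived k x * (arrived j x * (indicator A' (pos j x) * emeasure (\<kappa> (pos j x)) B'))
          * (indicator A (pos k x) * emeasure (\<kappa> (pos k x)) B) \<partial>P)"
      if "A \<in> sets borel" "B \<in> sets borel" for A B
    proof -
      have "(\<integral>\<^sup>+x. (arrived k x * (indicator A (pos k x) * indicator B (L k x)))
            * (arrived j x * (indicator A' (pos j x) * indicator B' (L j x))) \<partial>P)
          = (\<integral>\<^sup>+x. (arrived k x * (indicator A (pos k x) * emeasure (\<kappa> (pos k x)) B))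
            * (arrived j x * (indicator A' (pos j x) * emeasure (\<kappa> (pos j x)) B')) \<partial>P)"
        using nn_integral_marks[of "{k, j}" "\<lambda>i. if i = k then A else A'" "\<lambda>i. if i = k then B else B'"]
          that assms \<open>A' \<in> sets borel\<close> \<open>B' \<in> sets borel\<close> by simp
      then show ?thesis by (simp only: mult_ac)
    qed
  qed (use not_empty in measurable)
  have "(\<integral>\<^sup>+x. arrived j x * (arrived k x * indicator overshoot (pos k x, L k x))
        * indicator overshoot (pos j x, L j x) \<partial>P)
      = (\<integral>\<^sup>+x. arrived j x * (arrived k x * tail (pos k x)) * tail (pos j x) \<partial>P)"
    unfolding tail_def[of "pos j _"]
  proof (rule nn_integral_disintegrate[where P=P])
    show "(\<integral>\<^sup>+x. arrived j x * (arrived k x * indicator overshoot (pos k x, L k x)) \<partial>P) < \<infinity>"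
      by (intro nn_integral_le_1_finite) (auto simp: arrived_def split: split_indicator)
    show "(\<integral>\<^sup>+x. arrived j x * (arrived k x * indicator overshoot (pos k x, L k x))
          * (indicator A (pos j x) * indicator B (L j x)) \<partial>P)
        = (\<integral>\<^sup>+x. arrived j x * (arrived k x * tail (pos k x))
          * (indicator A (pos j x) * emeasure (\<kappa> (pos j x)) B) \<partial>P)"
      if "A \<in> sets borel" "B \<in> sets borel" for A B
      using first[OF that] by (simp only: mult_ac)
  qed (use not_empty in measurable)
  then show ?thesis
    unfolding active_def by (simp only: mult_ac)
qed

text \<open>Unlike \<open>active_jobs\<close>, this sum keeps the value infinity where it diverges,
  so integrals and sums interchange unconditionally. The two agree almost surely because almost
  surely only finitely many jobs arrive before \<open>T\<close>.\<close>

definition total :: "'a \<Rightarrow> ennreal" where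
  "total x = (\<Sum>k. active k x)"

lemma total_borel [measurable]: "total \<in> borel_measurable P"
  unfolding total_def by measurable

lemma nn_integral_total: "(\<integral>\<^sup>+x. total x \<partial>P) = (\<integral>\<^sup>+s. tail s \<partial>\<mu>T)"
proof -
  have "(\<integral>\<^sup>+x. total x \<partial>P) = (\<Sum>k. \<integral>\<^sup>+x. active k x \<partial>P)"
    unfolding total_def by (rule nn_integral_suminf) measurable
  then show ?thesis
    unfolding nn_integral_active using campbell[OF tail_borel] by simp
qed

text \<open>The diagonal terms \<open>k = j\<close> contribute the mean because \<open>active\<close> is an indicator.\<close>

lemma nn_integral_total_square:
  "(\<integral>\<^sup>+x. total x * total x \<partial>P) = (\<integral>\<^sup>+s. tail s \<partial>\<mu>T) * (\<integral>\<^sup>+s. tail s \<partial>\<mu>T) + (\<integral>\<^sup>+s. tail s \<partial>\<mu>T)"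
proof -
  have "active k x * active k x = active k x" for k x
    by (auto simp: active_def arrived_def split: split_indicator)
  then have "(\<integral>\<^sup>+x. total x * total x \<partial>P)
      = (\<integral>\<^sup>+x. (\<Sum>k. \<Sum>j. of_bool (k \<noteq> j) * (active k x * active j x)) + total x \<partial>P)"
    unfolding total_def suminf_off_diagonal by simp
  also have "\<dots> = (\<integral>\<^sup>+x. (\<Sum>k. \<Sum>j. of_bool (k \<noteq> j) * (active k x * active j x)) \<partial>P) + (\<integral>\<^sup>+x. total x \<partial>P)"
    by (rule nn_integral_add) measurable
  also have "(\<integral>\<^sup>+x. (\<Sum>k. \<Sum>j. of_bool (k \<noteq> j) * (active k x * active j x)) \<partial>P)
      = (\<Sum>k. \<integral>\<^sup>+x. (\<Sum>j. of_bool (k \<noteq> j) * (active k x * active j x)) \<partial>P)"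
    by (rule nn_integral_suminf) measurable
  also have "\<dots> = (\<Sum>k. \<Sum>j. of_bool (k \<noteq> j)
      * (\<integral>\<^sup>+x. arrived k x * tail (pos k x) * (arrived j x * tail (pos j x)) \<partial>P))"
  proof (rule suminf_cong)
    fix k
    have "(\<integral>\<^sup>+x. (\<Sum>j. of_bool (k \<noteq> j) * (active k x * active j x)) \<partial>P)
        = (\<Sum>j. \<integral>\<^sup>+x. of_bool (k \<noteq> j) * (active k x * active j x) \<partial>P)"
      by (rule nn_integral_suminf) measurable
    moreover have "(\<integral>\<^sup>+x. of_bool (k \<noteq> j) * (active k x * active j x) \<partial>P)
        = of_bool (k \<noteq> j) * (\<integral>\<^sup>+x. arrived k x * tail (pos k x) * (arrived j x * tail (pos j x)) \<partial>P)" for j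
      by (cases "k = j") (simp_all add: nn_integral_active_pair)
    ultimately show "(\<integral>\<^sup>+x. (\<Sum>j. of_bool (k \<noteq> j) * (active k x * active j x)) \<partial>P)
        = (\<Sum>j. of_bool (k \<noteq> j) * (\<integral>\<^sup>+x. arrived k x * tail (pos k x) * (arrived j x * tail (pos j x)) \<partial>P))"
      by simp
  qed
  finally show ?thesis
    unfolding campbell_off_diagonal[OF tail_borel tail_borel] nn_integral_total .
qed

lemma finite_tail: "(\<integral>\<^sup>+s. tail s \<partial>\<mu>T) < \<infinity>"
proof -
  have "(\<integral>\<^sup>+s. tail s \<partial>\<mu>T) \<le> (\<integral>\<^sup>+s. 1 \<partial>\<mu>T)"
    by (intro nn_integral_mono tail_le_1)
  also have "\<dots> < \<infinity>"
    using finite_measure.emeasure_finite[OF finite_\<mu>T] by (simp add: top.not_eq_extremum)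
  finally show ?thesis .
qed

lemma AE_active_jobs:
  "AE x in P. total x = ennreal (active_jobs \<Gamma> L T x) \<and> 0 \<le> active_jobs \<Gamma> L T x"
  using AE_count_finite[of UNIV, simplified]
proof eventually_elim
  case (elim x)
  have le: "\<Gamma> k x < ennreal T \<and> ennreal T < \<Gamma> k x + ennreal (L k x) \<longleftrightarrow>
      \<Gamma> k x < \<infinity> \<and> pos k x < T \<and> T < pos k x + L k x" for k
  proof (cases "\<Gamma> k x")
    case (real g)
    then have "\<Gamma> k x < ennreal T \<longleftrightarrow> g < T"
      by (simp add: ennreal_less_iff)
    moreover have "ennreal T < \<Gamma> k x + ennreal (L k x) \<longleftrightarrow> T < g + L k x" if "g < T"
    proof (cases "L k x \<ge> 0")
      case True
      then show ?thesis
        using real T_pos by (simp add: ennreal_less_iff flip: ennreal_plus)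
    next
      \<comment> \<open>A negative service time becomes 0 under \<open>ennreal\<close>; since the
        arrival precedes \<open>T\<close>, the job is inactive in both readings.\<close>
      case False
      then show ?thesis
        using real that T_pos by (simp add: ennreal_neg ennreal_less_iff)
    qed
    ultimately show ?thesis
      using real by (auto simp: pos_def)
  qed simp
  let ?a = "\<lambda>k. of_bool (\<Gamma> k x < ennreal T \<and> ennreal T < \<Gamma> k x + ennreal (L k x)) :: real"
  have active: "active k x = ennreal (?a k)" for k
    unfolding le by (auto simp: active_def arrived_def overshoot_def split: split_indicator)
  have "(\<Sum>k. arrived k x) < \<infinity>"
    using elim by (simp add: count_def)
  moreover have "total x \<le> (\<Sum>k. arrived k x)"
    unfolding total_def by (intro suminf_le) (auto simp: active_def split: split_indicator)
  ultimately have "(\<Sum>k. ennreal (?a k)) \<noteq> \<top>"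
    unfolding active[symmetric] by (auto simp: total_def)
  then have "summable ?a"
    by (intro summable_suminf_not_top) auto
  then show ?case
    unfolding total_def active active_jobs_def by (intro conjI suminf_ennreal2 suminf_nonneg) auto
qed

lemma active_jobs_borel [measurable]: "active_jobs \<Gamma> L T \<in> borel_measurable P"
  unfolding active_jobs_def by measurable

lemma active_jobs_moments:
  defines "N \<equiv> active_jobs \<Gamma> L T" and "m \<equiv> enn2real (\<integral>\<^sup>+s. tail s \<partial>\<mu>T)"
  shows "integrable P N" "integrable P (\<lambda>x. (N x)\<^sup>2)" "expectation N = m" "expectation (\<lambda>x. (N x)\<^sup>2) = m\<^sup>2 + m"
proof -
  note AE = AE_active_jobs[folded N_def]
  have [measurable]: "N \<in> borel_measurable P"
    unfolding N_def by measurable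
  have m: "(\<integral>\<^sup>+s. tail s \<partial>\<mu>T) = ennreal m" "m \<ge> 0"
    using finite_tail by (simp_all add: m_def)
  have "(\<integral>\<^sup>+x. ennreal (N x) \<partial>P) = (\<integral>\<^sup>+x. total x \<partial>P)"
    using AE by (intro nn_integral_cong_AE) auto
  then have 1: "(\<integral>\<^sup>+x. ennreal (N x) \<partial>P) = ennreal m"
    by (simp add: nn_integral_total m)
  have "(\<integral>\<^sup>+x. ennreal ((N x)\<^sup>2) \<partial>P) = (\<integral>\<^sup>+x. total x * total x \<partial>P)"
    using AE by (intro nn_integral_cong_AE) (auto simp: power2_eq_square ennreal_mult')
  then have 2: "(\<integral>\<^sup>+x. ennreal ((N x)\<^sup>2) \<partial>P) = ennreal (m\<^sup>2 + m)"
    using m(2) by (simp add: nn_integral_total_square m(1) power2_eq_square ennreal_mult')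
  show "integrable P N"
    using AE by (intro integrableI_nn_integral_finite[OF _ _ 1]) auto
  show "integrable P (\<lambda>x. (N x)\<^sup>2)"
    by (intro integrableI_nn_integral_finite[OF _ _ 2]) (auto simp: N_def)
  show "expectation N = m"
    using AE m(2) by (subst integral_eq_nn_integral) (auto simp: 1)
  show "expectation (\<lambda>x. (N x)\<^sup>2) = m\<^sup>2 + m"
    using m(2) by (subst integral_eq_nn_integral) (auto simp: 2 simp del: ennreal_plus)
qed

text \<open>Chebyshev's inequality around \<open>c\<close> instead of the mean, so the bound
  contains the squared bias besides the variance. Free \<open>a\<close> and \<open>c\<close> let one
  estimate serve both normalisations.\<close>

lemma active_jobs_deviation:
  fixes a c \<delta> :: real
  assumes "\<delta> > 0"
  defines "m \<equiv> enn2real (\<integral>\<^sup>+s. tail s \<partial>\<mu>T)"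
  shows "prob {x \<in> space P. \<delta> \<le> \<bar>a * active_jobs \<Gamma> L T x - c\<bar>} \<le> (a\<^sup>2 * m + (a * m - c)\<^sup>2) / \<delta>\<^sup>2"
proof -
  note mom = active_jobs_moments[folded m_def]
  let ?N = "active_jobs \<Gamma> L T"
  have sq: "(a * ?N x - c)\<^sup>2 = a\<^sup>2 * (?N x)\<^sup>2 - 2 * a * c * ?N x + c\<^sup>2" for x
    by (simp add: power2_diff power_mult_distrib)
  have int: "integrable P (\<lambda>x. (a * ?N x - c)\<^sup>2)"
    unfolding sq using mom(1,2) by auto
  have "expectation (\<lambda>x. (a * ?N x - c)\<^sup>2) = a\<^sup>2 * (m\<^sup>2 + m) - 2 * a * c * m + c\<^sup>2"
    unfolding sq using mom by (simp add: prob_space)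
  also have "\<dots> = a\<^sup>2 * m + (a * m - c)\<^sup>2"
    by (simp add: power2_diff power_mult_distrib algebra_simps)
  finally have e: "expectation (\<lambda>x. (a * ?N x - c)\<^sup>2) = a\<^sup>2 * m + (a * m - c)\<^sup>2" .
  have "{x \<in> space P. \<delta> \<le> \<bar>a * ?N x - c\<bar>} = {x \<in> space P. \<delta>\<^sup>2 \<le> (a * ?N x - c)\<^sup>2}"
    using \<open>\<delta> > 0\<close> by (auto simp: abs_le_square_iff[symmetric])
  also have "prob \<dots> \<le> expectation (\<lambda>x. (a * ?N x - c)\<^sup>2) / \<delta>\<^sup>2"
    using int \<open>\<delta> > 0\<close> by (intro integral_Markov_inequality_measure[where A="{}"]) auto
  finally show ?thesis unfolding e .
qed

end

section \<open>Averaging over a fast environment\<close>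

lemma borel_measurable_right_continuous:
  fixes f :: "real \<Rightarrow> 'b::metric_space"
  assumes "\<And>x. continuous (at_right x) f"
  shows "f \<in> borel_measurable borel"
proof (rule borel_measurable_LIMSEQ_metric)
  \<comment> \<open>The next grid point of mesh 1/(n+1) to the right of \<open>x\<close>. The
    \<open>+ 1\<close> makes it strictly larger than \<open>x\<close>, so that it approaches
    \<open>x\<close> within \<open>at_right x\<close>; as a function of \<open>x\<close> it takes
    countably many values.\<close>
  define g where "g n x = (real_of_int \<lfloor>real (Suc n) * x\<rfloor> + 1) / real (Suc n)" for n x
  show "(\<lambda>x. f (g n x)) \<in> borel_measurable borel" for n
  proof -
    have "(\<lambda>i::int. f ((real_of_int i + 1) / real (Suc n))) \<in> count_space UNIV \<rightarrow>\<^sub>M borel"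
      by simp
    moreover have "(\<lambda>x. \<lfloor>real (Suc n) * x\<rfloor>) \<in> borel \<rightarrow>\<^sub>M count_space UNIV"
      by measurable
    ultimately show ?thesis
      unfolding g_def by (rule measurable_compose[rotated])
  qed
  show "(\<lambda>n. f (g n x)) \<longlonglongrightarrow> f x" for x
  proof -
    have gt: "x < g n x" and le: "g n x \<le> x + 1 / real (Suc n)" for n
    proof -
      have "real (Suc n) * x < real_of_int \<lfloor>real (Suc n) * x\<rfloor> + 1" "real_of_int \<lfloor>real (Suc n) * x\<rfloor> \<le> real (Suc n) * x"
        by linarith+
      then show "x < g n x" "g n x \<le> x + 1 / real (Suc n)"
        unfolding g_def by (simp_all add: field_simps del: of_nat_Suc)
    qed
    have "(\<lambda>n. x + 1 / real (Suc n)) \<longlonglongrightarrow> x + 0"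
      by (intro tendsto_add tendsto_const LIMSEQ_Suc lim_1_over_n)
    then have "(\<lambda>n. g n x) \<longlonglongrightarrow> x"
      using gt le by (intro tendsto_sandwich[of "\<lambda>_. x" "\<lambda>n. g n x" sequentially "\<lambda>n. x + 1 / real (Suc n)"])
        (auto intro!: always_eventually less_imp_le simp del: of_nat_Suc)
    then have "filterlim (\<lambda>n. g n x) (at_right x) sequentially"
      using gt by (simp add: filterlim_at less_imp_neq[THEN not_sym])
    then show ?thesis
      using assms[of x] unfolding continuous_within by (rule filterlim_compose[rotated])
  qed
qed

lemma normalized_density:
  fixes w g :: "real \<Rightarrow> real"
  assumes [measurable]: "w \<in> borel_measurable borel"
    and w: "\<And>s. 0 \<le> w s" "\<And>s. w s \<le> V"
    and c: "c = (LBINT s:{0..T}. w s)" "c > 0"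
  defines "D \<equiv> density lborel (\<lambda>s. ennreal (indicator {0..T} s * w s / c))"
  shows "real_distribution D"
    and "cdf D x = (LBINT s:{0..min x T}. w s) / c"
    and "g \<in> borel_measurable borel \<Longrightarrow> integral\<^sup>L D g = (LBINT s:{0..T}. g s * w s) / c"
    and "emeasure D ({..0} \<union> {T..}) = 0"
proof -
  have int: "integrable lborel (\<lambda>s. indicator A s * w s)" if "A \<subseteq> {0..T}" and [measurable]: "A \<in> sets borel" for A
  proof (rule Bochner_Integration.integrable_bound)
    show "integrable lborel (\<lambda>s. indicator {0..T} s * V)"
      by (intro integrable_mult_left integrable_real_indicator) (auto simp: emeasure_lborel_Icc_eq)
    show "AE s in lborel. norm (indicator A s * w s) \<le> norm (indicator {0..T} s * V)"
      using w that order_trans[OF w] by (intro always_eventually) (auto split: split_indicator)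
  qed measurable
  have em: "emeasure D B = ennreal ((LBINT s:B \<inter> {0..T}. w s) / c)" if [measurable]: "B \<in> sets borel" for B
  proof -
    have "emeasure D B = (\<integral>\<^sup>+s. ennreal (indicator (B \<inter> {0..T}) s * w s / c) \<partial>lborel)"
      unfolding D_def by (subst emeasure_density) (auto intro!: nn_integral_cong split: split_indicator)
    also have "\<dots> = ennreal (\<integral>s. indicator (B \<inter> {0..T}) s * w s / c \<partial>lborel)"
      using int[of "B \<inter> {0..T}"] w c(2) by (intro nn_integral_eq_integral) auto
    finally show ?thesis
      by (simp add: set_lebesgue_integral_def)
  qed
  have meas: "measure D B = (LBINT s:B \<inter> {0..T}. w s) / c" if "B \<in> sets borel" for B
    unfolding measure_def em[OF that] using w c(2)
    by (intro enn2real_ennreal divide_nonneg_pos) (auto simp: set_lebesgue_integral_def intro!: integral_nonneg_AE)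
  have sets: "sets D = sets borel" "space D = UNIV"
    by (simp_all add: D_def)
  show "real_distribution D"
  proof (intro real_distribution.intro real_distribution_axioms.intro prob_spaceI)
    show "emeasure D (space D) = 1"
      using em[of UNIV] c by (simp add: sets)
  qed (simp add: sets)
  have "{..x} \<inter> {0..T} = {0..min x T}" by auto
  then show "cdf D x = (LBINT s:{0..min x T}. w s) / c"
    unfolding cdf_def using meas[of "{..x}"] by simp
  show "integral\<^sup>L D g = (LBINT s:{0..T}. g s * w s) / c" if [measurable]: "g \<in> borel_measurable borel"
    unfolding D_def using w c(2)
    by (subst integral_density)
       (auto simp: set_lebesgue_integral_def mult_ac simp flip: integral_divide_zero intro!: Bochner_Integration.integral_cong)
  have "(LBINT s:({..0} \<union> {T..}) \<inter> {0..T}. w s) = 0"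
    unfolding set_lebesgue_integral_def
  proof (rule integral_eq_zero_AE)
    show "AE s in lborel. indicator (({..0} \<union> {T..}) \<inter> {0..T}) s *\<^sub>R w s = 0"
      using AE_lborel_singleton[of 0] AE_lborel_singleton[of T]
      by eventually_elim (auto split: split_indicator)
  qed
  then show "emeasure D ({..0} \<union> {T..}) = 0"
    by (subst em) auto
qed

text \<open>
  The normalised measures with density \<open>v (s / \<epsilon>)\<close> on \<open>{0..T}\<close> converge weakly to the uniform
  distribution, and the discontinuities of \<open>g\<close> form a null set for the limit.
\<close>

lemma averaging_principle:
  fixes g v :: "real \<Rightarrow> real"
  assumes "T > 0" and g[measurable]: "g \<in> borel_measurable borel" and "\<And>s. \<bar>g s\<bar> \<le> B"
    and cont: "\<And>s. 0 < s \<Longrightarrow> s < T \<Longrightarrow> isCont g s"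
    and [measurable]: "v \<in> borel_measurable borel" and v: "\<And>s. 0 \<le> v s" "\<And>s. v s \<le> V"
    and "vbar > 0" and avg: "((\<lambda>t. (1 / t) * (LBINT u:{0..t}. v u)) \<longlongrightarrow> vbar) at_top"
  shows "((\<lambda>\<epsilon>. LBINT s:{0..T}. g s * v (s / \<epsilon>)) \<longlongrightarrow> vbar * (LBINT s:{0..T}. g s)) (at_right 0)"
proof -
  have F: "((\<lambda>\<epsilon>. LBINT s:{0..u}. v (s / \<epsilon>)) \<longlongrightarrow> u * vbar) (at_right 0)" if "u > 0" for u
  proof -
    \<comment> \<open>The substitution s = \<epsilon> s' turns the integral over
      \<open>{0..u}\<close> into \<open>u\<close> times a time average over the horizon u /
      \<epsilon>, which tends to infinity.\<close>
    have "u * ((1 / (u / \<epsilon>)) * (LBINT s:{0..u / \<epsilon>}. v s)) = (LBINT s:{0..u}. v (s / \<epsilon>))" if "\<epsilon> > 0" for \<epsilon>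
    proof -
      have "(LBINT s:{0..u}. v (s / \<epsilon>)) = \<epsilon> * (\<integral>s. indicator {0..u} (\<epsilon> * s) * v s \<partial>lborel)"
        using lborel_integral_real_affine[of \<epsilon> "\<lambda>s. indicator {0..u} s * v (s / \<epsilon>)" 0] \<open>\<epsilon> > 0\<close>
        by (simp add: set_lebesgue_integral_def)
      also have "(\<lambda>s. indicator {0..u} (\<epsilon> * s) * v s) = (\<lambda>s. indicator {0..u / \<epsilon>} s * v s)"
        using \<open>\<epsilon> > 0\<close> by (auto simp: fun_eq_iff field_simps zero_le_mult_iff split: split_indicator)
      finally show ?thesis
        using \<open>u > 0\<close> by (simp add: set_lebesgue_integral_def)
    qed
    then have "eventually (\<lambda>\<epsilon>. u * ((1 / (u / \<epsilon>)) * (LBINT s:{0..u / \<epsilon>}. v s)) = (LBINT s:{0..u}. v (s / \<epsilon>))) (at_right 0)"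
      by (auto simp: eventually_at_filter)
    moreover have "filterlim (\<lambda>\<epsilon>. u / \<epsilon>) at_top (at_right 0)"
      unfolding divide_inverse using \<open>u > 0\<close>
      by (intro filterlim_tendsto_pos_mult_at_top[OF tendsto_const _ filterlim_inverse_at_top_right])
    then have "((\<lambda>\<epsilon>. u * ((1 / (u / \<epsilon>)) * (LBINT s:{0..u / \<epsilon>}. v s))) \<longlongrightarrow> u * vbar) (at_right 0)"
      by (intro tendsto_mult tendsto_const filterlim_compose[OF avg])
    ultimately show ?thesis
      by (rule Lim_transform_eventually[rotated])
  qed
  show ?thesis
  proof (rule tendsto_at_right_sequentially[of 0 1])
    fix S :: "nat \<Rightarrow> real"
    assume S: "\<And>n. 0 < S n" "S \<longlonglongrightarrow> 0"
    then have lim: "filterlim S (at_right 0) sequentially"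
      by (simp add: filterlim_at less_imp_neq[THEN not_sym])
    have pos: "T * vbar > 0"
      using \<open>T > 0\<close> \<open>vbar > 0\<close> by simp
    have "eventually (\<lambda>n. (LBINT s:{0..T}. v (s / S n)) > 0) sequentially"
      using order_tendstoD(1)[OF filterlim_compose[OF F[OF \<open>T > 0\<close>] lim] pos] .
    then obtain N where N: "\<And>n. n \<ge> N \<Longrightarrow> (LBINT s:{0..T}. v (s / S n)) > 0"
      by (auto simp: eventually_sequentially)
    \<comment> \<open>Dropping the first \<open>N\<close> terms makes every normalising constant
      positive, as \<open>normalized_density\<close> demands; \<open>LIMSEQ_offset\<close> restores
      them at the end.\<close>
    define X where "X n = S (n + N)" for n
    have limX: "filterlim X (at_right 0) sequentially"
      unfolding X_def using lim filterlim_compose filterlim_add_const_nat_at_top by blast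
    define c where "c n = (LBINT s:{0..T}. v (s / X n))" for n
    have c: "c n > 0" for n
      using N by (simp add: c_def X_def)
    have climit: "c \<longlonglongrightarrow> T * vbar"
      unfolding c_def by (rule filterlim_compose[OF F[OF \<open>T > 0\<close>] limX])
    define D where "D n = density lborel (\<lambda>s. ennreal (indicator {0..T} s * v (s / X n) / c n))" for n
    define U where "U = density lborel (\<lambda>s. ennreal (indicator {0..T} s * 1 / T))"
    note D = normalized_density[of "\<lambda>s. v (s / X n)" V "c n" T for n,
        OF _ v c_def c, folded D_def, simplified]
    have T: "T = (LBINT s:{0..T}. 1)"
      using \<open>T > 0\<close> by (simp add: set_lebesgue_integral_def)
    note U = normalized_density[of "\<lambda>_. 1" 1, OF _ _ _ T \<open>T > 0\<close>, folded U_def, simplified]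
    have "weak_conv_m D U"
      unfolding weak_conv_m_def weak_conv_def
    proof (intro allI impI)
      fix x
      show "(\<lambda>n. cdf (D n) x) \<longlonglongrightarrow> cdf U x"
      proof (cases "min x T > 0")
        case True
        have "(\<lambda>n. (LBINT s:{0..min x T}. v (s / X n)) / c n) \<longlonglongrightarrow> (min x T * vbar) / (T * vbar)"
          using pos by (intro tendsto_divide climit filterlim_compose[OF F[OF True] limX]) auto
        moreover have "(LBINT s:{0..min x T}. 1) = min x T"
          using True by (simp add: set_lebesgue_integral_def)
        ultimately show ?thesis
          using \<open>vbar > 0\<close> unfolding D(2) U(2) by simp
      next
        case False
        \<comment> \<open>Here the interval is empty or the single point 0, so both distribution
          functions vanish.\<close>
        have "(LBINT s:{0..min x T}. f s) = 0" for f :: "real \<Rightarrow> real"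
          unfolding set_lebesgue_integral_def
        proof (rule integral_eq_zero_AE)
          show "AE s in lborel. indicator {0..min x T} s *\<^sub>R f s = 0"
            using AE_lborel_singleton[of 0] by eventually_elim (use False in \<open>auto split: split_indicator\<close>)
        qed
        then show ?thesis
          unfolding D(2) U(2) by simp
      qed
    qed
    moreover have "emeasure U {s. \<not> isCont g s} = 0"
    proof -
      have "{s. \<not> isCont g s} \<subseteq> {..0} \<union> {T..}"
      proof
        fix s assume "s \<in> {s. \<not> isCont g s}"
        then show "s \<in> {..0} \<union> {T..}"
          using cont[of s] by (cases "0 < s \<and> s < T") auto
      qed
      then have "emeasure U {s. \<not> isCont g s} \<le> emeasure U ({..0} \<union> {T..})"
        by (rule emeasure_mono) (simp add: U_def)
      then show ?thesis
        unfolding U(4) by simp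
    qed
    ultimately have "(\<lambda>n. integral\<^sup>L (D n) g) \<longlonglongrightarrow> integral\<^sup>L U g"
      using assms(3) by (intro weak_conv_imp_bdd_ae_continuous_conv[OF D(1) U(1) _ _ _ g]) auto
    \<comment> \<open>Multiplying by the masses \<open>c n\<close>, which tend to
      \<open>T * vbar\<close>, undoes the normalisation.\<close>
    then have "(\<lambda>n. c n * ((LBINT s:{0..T}. g s * v (s / X n)) / c n))
        \<longlonglongrightarrow> (T * vbar) * ((LBINT s:{0..T}. g s) / T)"
      unfolding D(3)[OF g] U(3)[OF g] by (intro tendsto_mult climit)
    moreover have "c n * ((LBINT s:{0..T}. g s * v (s / X n)) / c n) = (LBINT s:{0..T}. g s * v (s / X n))" for n
      using c[of n] by simp
    ultimately have "(\<lambda>n. LBINT s:{0..T}. g s * v (s / S (n + N))) \<longlonglongrightarrow> vbar * (LBINT s:{0..T}. g s)"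
      using \<open>T > 0\<close> by (simp add: X_def)
    then show "(\<lambda>n. LBINT s:{0..T}. g s * v (s / S n)) \<longlonglongrightarrow> vbar * (LBINT s:{0..T}. g s)"
      by (rule LIMSEQ_offset)
  qed simp
qed

section \<open>Regularity of the service laws\<close>

context queue_in_random_environment
begin

abbreviation dens :: "real \<Rightarrow> real \<Rightarrow> real" where
  "dens s r \<equiv> indicator {0..} r * ell s r"

lemma dens_borel: "s \<ge> 0 \<Longrightarrow> dens s \<in> borel_measurable borel"
  using ell_measurable unfolding set_borel_measurable_def by simp

lemma dens_nonneg: "s \<ge> 0 \<Longrightarrow> 0 \<le> dens s r"
  using ell_nonneg by (simp add: indicator_def)

lemma integrable_dens:
  assumes "s \<ge> 0"
  shows "integrable lborel (dens s)"
proof (rule integrableI_nonneg)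
  have [measurable]: "dens s \<in> borel_measurable lborel"
    using dens_borel[OF assms] by simp
  have "(\<integral>\<^sup>+r. ennreal (dens s r) \<partial>lborel) = emeasure (service_law ell s) (space (service_law ell s))"
    unfolding service_law_def by (subst emeasure_density) auto
  then show "(\<integral>\<^sup>+r. ennreal (dens s r) \<partial>lborel) < \<infinity>"
    using prob_space.emeasure_space_1[OF service_law_prob[OF assms]] by simp
qed (use dens_borel dens_nonneg assms in auto)

text \<open>
  The lower bound on \<open>ell 1\<close> makes a multiple of \<open>ell 1\<close> itself an integrable dominating function.
\<close>

lemma dens_dominated:
  obtains D where "integrable lborel D" "\<And>s r. s > 0 \<Longrightarrow> r \<noteq> 0 \<Longrightarrow> dens s r \<le> D r"
proof -
  obtain c C where "c > 0" "C > 0" and bnd: "\<And>r s. r > 0 \<Longrightarrow> s > 0 \<Longrightarrow>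
      c * min (r powr (- 1 - \<alpha>)) 1 \<le> ell s r \<and> ell s r \<le> C * min (r powr (- 1 - \<alpha>)) 1"
    using ell_bounds by blast
  show thesis
  proof
    show "integrable lborel (\<lambda>r. C / c * dens 1 r)"
      using integrable_dens[of 1] by simp
    fix s r :: real assume "s > 0" "r \<noteq> 0"
    show "dens s r \<le> C / c * dens 1 r"
    proof (cases "r > 0")
      case True
      have "ell s r \<le> C / c * (c * min (r powr (- 1 - \<alpha>)) 1)"
        using bnd[OF True \<open>s > 0\<close>] \<open>c > 0\<close> by simp
      also have "\<dots> \<le> C / c * ell 1 r"
        using bnd[OF True, of 1] \<open>c > 0\<close> \<open>C > 0\<close> by (intro mult_left_mono) auto
      finally show ?thesis using True by simp
    next
      case False
      then show ?thesis using \<open>r \<noteq> 0\<close> by simp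
    qed
  qed
qed

lemma ell_positive: "s > 0 \<Longrightarrow> r > 0 \<Longrightarrow> ell s r > 0"
proof -
  assume "s > 0" "r > 0"
  obtain c where "c > 0" "c * min (r powr (- 1 - \<alpha>)) 1 \<le> ell s r"
    using ell_bounds \<open>s > 0\<close> \<open>r > 0\<close> by blast
  moreover have "0 < c * min (r powr (- 1 - \<alpha>)) 1"
    using \<open>c > 0\<close> \<open>r > 0\<close> by simp
  ultimately show ?thesis by simp
qed

lemma isCont_ell:
  assumes "s > 0" "r > 0"
  shows "isCont (\<lambda>u. ell u r) s"
proof -
  obtain D where "((\<lambda>u. ell u r) has_real_derivative D) (at s)"
    using ell_bounds assms by blast
  then show ?thesis by (rule DERIV_isCont)
qed

text \<open>Dominated convergence in a form used twice: a constant \<open>f\<close> gives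
  measurability of the service kernel, and indicators with a moving threshold give continuity of the
  survival term. The bound on \<open>dens\<close> may fail at r = 0, which is a null set.\<close>

lemma tendsto_integral_dens:
  fixes f :: "nat \<Rightarrow> real \<Rightarrow> real"
  assumes u: "\<And>n. u n > 0" "u \<longlonglongrightarrow> s" "s > 0"
    and [measurable]: "\<And>n. f n \<in> borel_measurable borel" "f0 \<in> borel_measurable borel"
    and f: "\<And>n r. \<bar>f n r\<bar> \<le> 1" "AE r in lborel. (\<lambda>n. f n r) \<longlonglongrightarrow> f0 r"
  shows "(\<lambda>n. \<integral>r. f n r * dens (u n) r \<partial>lborel) \<longlonglongrightarrow> (\<integral>r. f0 r * dens s r \<partial>lborel)"
proof -
  obtain D where D: "integrable lborel D" "\<And>s r. s > 0 \<Longrightarrow> r \<noteq> 0 \<Longrightarrow> dens s r \<le> D r"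
    using dens_dominated by blast
  have [measurable]: "dens s \<in> borel_measurable borel" "dens (u n) \<in> borel_measurable borel" for n
    using dens_borel u(1)[of n] u(3) by auto
  show ?thesis
  proof (rule integral_dominated_convergence[where w=D])
    show "AE r in lborel. (\<lambda>n. f n r * dens (u n) r) \<longlonglongrightarrow> f0 r * dens s r"
      using f(2) AE_lborel_singleton[of 0]
    proof eventually_elim
      case (elim r)
      have "(\<lambda>n. dens (u n) r) \<longlonglongrightarrow> dens s r"
      proof (cases "r > 0")
        case True
        then show ?thesis
          using isCont_tendsto_compose[OF isCont_ell[OF u(3) True] u(2)] by simp
      next
        case False
        then show ?thesis using elim by simp
      qed
      then show ?case
        by (rule tendsto_mult[OF elim(1)])
    qed
    show "AE r in lborel. norm (f n r * dens (u n) r) \<le> D r" for n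
      using AE_lborel_singleton[of 0]
    proof eventually_elim
      case (elim r)
      have d: "0 \<le> dens (u n) r"
        using dens_nonneg u(1)[of n] by simp
      have "norm (f n r * dens (u n) r) = \<bar>f n r\<bar> * dens (u n) r"
        unfolding real_norm_def abs_mult[of "f n r"] abs_of_nonneg[OF d] ..
      also have "\<dots> \<le> 1 * dens (u n) r"
        using f(1) d by (rule mult_right_mono)
      also have "\<dots> \<le> D r"
        using D(2)[OF u(1)[of n] elim] by simp
      finally show ?case .
    qed
  qed (use D in auto)
qed

section \<open>Survival function and service kernel\<close>

lemma measure_service_law:
  assumes "s \<ge> 0" and [measurable]: "B \<in> sets borel"
  shows "measure (service_law ell s) B = (\<integral>r. indicator B r * dens s r \<partial>lborel)"
proof -
  have [measurable]: "dens s \<in> borel_measurable borel"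
    using dens_borel[OF assms(1)] .
  have "emeasure (service_law ell s) B = (\<integral>\<^sup>+r. ennreal (indicator B r * dens s r) \<partial>lborel)"
    unfolding service_law_def
    by (subst emeasure_density) (auto intro!: nn_integral_cong split: split_indicator)
  then show ?thesis
    unfolding measure_def using dens_nonneg[OF assms(1)] by (subst integral_eq_nn_integral) auto
qed

lemma survival_eq_integral:
  assumes "r \<ge> 0"
  shows "survival ell s r = (\<integral>\<tau>. indicator {r..} \<tau> * dens s \<tau> \<partial>lborel)"
  unfolding survival_def set_lebesgue_integral_def using assms
  by (intro Bochner_Integration.integral_cong) (auto split: split_indicator)

text \<open>\<open>survival\<close> integrates over a closed half line, while a job is active only
  if it strictly outlives the observation time; a law with a density does not see the
  endpoint.\<close>

lemma survival_eq_measure: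
  assumes "s \<ge> 0" "r \<ge> 0"
  shows "survival ell s r = measure (service_law ell s) {r<..}"
proof -
  have [measurable]: "dens s \<in> borel_measurable borel"
    using dens_borel[OF assms(1)] .
  have "(\<integral>\<tau>. indicator {r..} \<tau> * dens s \<tau> \<partial>lborel) = (\<integral>\<tau>. indicator {r<..} \<tau> * dens s \<tau> \<partial>lborel)"
  proof (rule integral_cong_AE)
    show "AE \<tau> in lborel. indicator {r..} \<tau> * dens s \<tau> = indicator {r<..} \<tau> * dens s \<tau>"
      using AE_lborel_singleton[of r] by eventually_elim (auto split: split_indicator)
  qed measurable
  then show ?thesis
    using assms by (simp add: survival_eq_integral measure_service_law)
qed

lemma survival_bounds: "s \<ge> 0 \<Longrightarrow> r \<ge> 0 \<Longrightarrow> 0 \<le> survival ell s r \<and> survival ell s r \<le> 1"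
  using prob_space.prob_le_1[OF service_law_prob] by (simp add: survival_eq_measure)

lemma survival_positive:
  assumes "s > 0" "r > 0"
  shows "survival ell s r > 0"
proof (rule ccontr)
  have [measurable]: "dens s \<in> borel_measurable borel"
    using dens_borel assms(1) by simp
  assume "\<not> survival ell s r > 0"
  then have "survival ell s r = 0"
    using survival_bounds[of s r] assms by simp
  then have "(\<integral>\<tau>. indicator {r..} \<tau> * dens s \<tau> \<partial>lborel) = 0"
    using assms by (simp add: survival_eq_integral)
  moreover have "integrable lborel (\<lambda>\<tau>. indicator {r..} \<tau> * dens s \<tau>)"
    using integrable_mult_indicator[OF _ integrable_dens[of s], of "{r..}"] assms by simp
  ultimately have "AE \<tau> in lborel. indicator {r..} \<tau> * dens s \<tau> = 0"
    using dens_nonneg[of s] assms by (subst (asm) integral_nonneg_eq_0_iff_AE) auto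
  \<comment> \<open>The density is strictly positive beyond \<open>r\<close>, so a vanishing
    integral would make an interval of length 1 a null set.\<close>
  then have "AE \<tau> in lborel. \<tau> \<notin> {r..r + 1}"
  proof eventually_elim
    case (elim \<tau>)
    then show ?case
      using ell_positive[OF assms(1), of \<tau>] assms(2) by (auto split: split_indicator_asm)
  qed
  then have "{r..r + 1} \<in> null_sets lborel"
    by (subst (asm) AE_iff_null_sets[symmetric]) auto
  then show False
    by (auto simp: null_sets_def)
qed

text \<open>
  Continuity of \<open>ell\<close> in its first argument is only available on the open half line; the values of
  \<open>kernel\<close> at \<open>s \<le> 0\<close> are irrelevant because arrivals are almost surely positive.
\<close>

definition kernel :: "real \<Rightarrow> real measure" where
  "kernel s = service_law ell (if s > 0 then s else 1)"

lemma sets_service_law: "sets (service_law ell s) = sets borel"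
  by (simp add: service_law_def)

text \<open>For each Borel set the kernel mass is continuous in s on the positive half line and
  constant elsewhere. With all Borel sets as generator, measurability of these evaluations is what
  the criterion asks for.\<close>

lemma kernel_measurable: "kernel \<in> borel \<rightarrow>\<^sub>M prob_algebra borel"
proof (rule measurable_prob_algebra_generated[where \<Omega>=UNIV and G="sets borel"])
  show "prob_space (kernel s)" for s
    unfolding kernel_def by (intro service_law_prob) auto
  show "(\<lambda>s. emeasure (kernel s) B) \<in> borel_measurable borel" if "B \<in> sets borel" for B
  proof -
    have "continuous_on {0<..} (\<lambda>s. \<integral>r. indicator B r * dens s r \<partial>lborel)"
      unfolding continuous_on_sequentially o_def
      using that by (auto intro!: tendsto_integral_dens split: split_indicator)
    then have "(\<lambda>s. if s \<in> {0<..} then \<integral>r. indicator B r * dens s r \<partial>lborel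
        else \<integral>r. indicator B r * dens 1 r \<partial>lborel) \<in> borel_measurable borel"
      by (intro borel_measurable_continuous_on_if) auto
    moreover have "emeasure (kernel s) B = ennreal (if s \<in> {0<..} then \<integral>r. indicator B r * dens s r \<partial>lborel
        else \<integral>r. indicator B r * dens 1 r \<partial>lborel)" for s
    proof -
      have "prob_space (kernel s)"
        unfolding kernel_def by (intro service_law_prob) auto
      then have "emeasure (kernel s) B = ennreal (measure (kernel s) B)"
        by (intro finite_measure.emeasure_eq_measure prob_space.axioms)
      then show ?thesis
        using that by (cases "s > 0") (simp_all add: kernel_def measure_service_law)
    qed
    ultimately show ?thesis using measurable_compose[OF _ measurable_ennreal] by (simp only:)
  qed
  show "sets borel = sigma_sets UNIV (sets (borel :: real measure))"
    using sets.sigma_sets_eq[of "borel :: real measure"] by simp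
  show "Int_stable (sets (borel :: real measure))"
    by (auto simp: Int_stable_def)
qed (simp_all add: kernel_def sets_service_law)

text \<open>Both the density and the threshold t - s move with s. The indicators of the moving half
  lines converge except at the limiting threshold, a null set.\<close>

lemma continuous_survival:
  assumes "0 < s" "s < t"
  shows "isCont (\<lambda>s. survival ell s (t - s)) s"
  unfolding continuous_at_sequentially o_def
proof (intro allI impI)
  fix u assume u: "u \<longlonglongrightarrow> s"
  have "eventually (\<lambda>n. 0 < u n \<and> u n < t) sequentially"
    using order_tendstoD[OF u] assms by (auto intro: eventually_conj)
  then obtain N where N: "\<And>n. n \<ge> N \<Longrightarrow> 0 < u n \<and> u n < t"
    by (auto simp: eventually_sequentially)
  define w where "w n = u (n + N)" for n
  have w: "w \<longlonglongrightarrow> s" "\<And>n. 0 < w n" "\<And>n. w n < t"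
    using LIMSEQ_ignore_initial_segment[OF u, of N] N by (auto simp: w_def[abs_def])
  have "(\<lambda>n. \<integral>\<tau>. indicator {t - w n..} \<tau> * dens (w n) \<tau> \<partial>lborel)
      \<longlonglongrightarrow> (\<integral>\<tau>. indicator {t - s..} \<tau> * dens s \<tau> \<partial>lborel)"
  proof (rule tendsto_integral_dens)
    show "AE \<tau> in lborel. (\<lambda>n. indicator {t - w n..} \<tau>) \<longlonglongrightarrow> (indicator {t - s..} \<tau> :: real)"
      using AE_lborel_singleton[of "t - s"]
    proof eventually_elim
      case (elim \<tau>)
      have "eventually (\<lambda>n. indicator {t - w n..} \<tau> = (indicator {t - s..} \<tau> :: real)) sequentially"
      proof (cases "\<tau> < t - s")
        case True
        then have "eventually (\<lambda>n. w n < t - \<tau>) sequentially"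
          using order_tendstoD(2)[OF w(1)] by simp
        then show ?thesis
          by eventually_elim (use True in \<open>auto split: split_indicator\<close>)
      next
        case False
        then have "eventually (\<lambda>n. t - \<tau> < w n) sequentially"
          using elim order_tendstoD(1)[OF w(1)] by simp
        then show ?thesis
          by eventually_elim (use False in \<open>auto split: split_indicator\<close>)
      qed
      then show ?case by (rule tendsto_eventually)
    qed
  qed (use w assms in \<open>auto split: split_indicator\<close>)
  then have "(\<lambda>n. survival ell (w n) (t - w n)) \<longlonglongrightarrow> survival ell s (t - s)"
    using w assms by (simp add: survival_eq_integral less_imp_le)
  then show "(\<lambda>n. survival ell (u n) (t - u n)) \<longlonglongrightarrow> survival ell s (t - s)"
    unfolding w_def by (rule LIMSEQ_offset)
qed

section \<open>Quenched law of large numbers\<close>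

text \<open>Right-continuity of \<open>Z\<close> is known from time 0 on; freezing the path at its
  initial value before that gives a Borel function on the whole line.\<close>

definition env :: "'a \<Rightarrow> real \<Rightarrow> real" where
  "env \<omega> u = \<psi> (Z (max 0 u) \<omega>)"

lemma env_positive: "env \<omega> u > 0"
  by (simp add: env_def \<psi>_positive)

lemma continuous_\<psi>: "continuous_on UNIV \<psi>"
  using \<psi>_lipschitz lipschitz_on_continuous_on by blast

lemma continuous_lam: "continuous_on {0..} lam"
  using lam_lipschitz lipschitz_on_continuous_on by blast

lemma env_borel:
  assumes "\<omega> \<in> space M"
  shows "env \<omega> \<in> borel_measurable borel"
proof (rule borel_measurable_right_continuous)
  fix x :: real
  have "((\<lambda>u. Z (max 0 u) \<omega>) \<longlongrightarrow> Z (max 0 x) \<omega>) (at_right x)"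
  proof (cases "x \<ge> 0")
    case True
    have "((\<lambda>u. Z u \<omega>) \<longlongrightarrow> Z x \<omega>) (at_right x)"
      using Z_right_continuous[OF assms True] by (simp add: continuous_within)
    moreover have "eventually (\<lambda>u. Z u \<omega> = Z (max 0 u) \<omega>) (at_right x)"
      using eventually_at_right_less by eventually_elim (use True in simp)
    ultimately show ?thesis
      using True by (simp add: tendsto_cong)
  next
    case False
    then have "eventually (\<lambda>u. u < 0) (at_right x)"
      by (intro eventually_at_right_real[of x 0, THEN eventually_mono]) auto
    then have "eventually (\<lambda>u. Z (max 0 u) \<omega> = Z (max 0 x) \<omega>) (at_right x)"
      by eventually_elim (use False in simp)
    then show ?thesis by (rule tendsto_eventually)
  qed
  then show "continuous (at_right x) (env \<omega>)"
    unfolding continuous_within env_def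
    using continuous_on_tendsto_compose[OF continuous_\<psi>] by fastforce
qed

lemma \<psi>_bound: obtains V where "\<And>z. \<psi> z \<le> V"
  using \<psi>_bounded by (auto simp: bounded_iff abs_le_iff)

lemma lam_bound: obtains B where "\<And>s. s \<ge> 0 \<Longrightarrow> lam s \<le> B"
  using lam_bounded by (auto simp: bounded_iff abs_le_iff)

section \<open>The averaged mean and its integrand\<close>

lemma mean_environment_positive: "(\<integral>z. \<psi> z \<partial>\<pi>) > 0"
proof -
  interpret \<pi>: prob_space \<pi>
    using \<pi>_invariant by (simp add: invariant_prob_def space_prob_algebra)
  have [measurable_cong]: "sets \<pi> = sets borel"
    using \<pi>_invariant by (simp add: invariant_prob_def space_prob_algebra)
  have [measurable]: "\<psi> \<in> borel_measurable borel"
    by (rule borel_measurable_continuous_onI[OF continuous_\<psi>])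
  obtain V where V: "\<And>z. \<psi> z \<le> V"
    using \<psi>_bound by blast
  have int: "integrable \<pi> \<psi>"
    using V \<psi>_positive by (intro \<pi>.integrable_const_bound[where B=V]) (auto simp: less_imp_le)
  have "(\<integral>z. \<psi> z \<partial>\<pi>) \<noteq> 0"
  proof
    assume "(\<integral>z. \<psi> z \<partial>\<pi>) = 0"
    then have "AE z in \<pi>. \<psi> z = 0"
      using int \<psi>_positive by (subst (asm) integral_nonneg_eq_0_iff_AE) (auto simp: less_imp_le)
    then have "AE z in \<pi>. False"
      by eventually_elim (use \<psi>_positive in \<open>simp add: less_imp_neq[THEN not_sym]\<close>)
    then show False by simp
  qed
  moreover have "(\<integral>z. \<psi> z \<partial>\<pi>) \<ge> 0"
    using \<psi>_positive by (intro integral_nonneg_AE) (auto simp: less_imp_le)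
  ultimately show ?thesis by simp
qed

text \<open>The integrand of the averaged mean, set to 0 outside the open interval because
  continuity of the survival term is proved only inside it. The endpoints change no
  integral.\<close>

definition weight :: "real \<Rightarrow> real \<Rightarrow> real" where
  "weight t s = (if s \<in> {0<..<t} then lam s * survival ell s (t - s) else 0)"

lemma continuous_weight: "continuous_on {0<..<t} (\<lambda>s. lam s * survival ell s (t - s))"
proof (intro continuous_on_mult)
  show "continuous_on {0<..<t} lam"
    using continuous_lam by (rule continuous_on_subset) auto
  show "continuous_on {0<..<t} (\<lambda>s. survival ell s (t - s))"
    using continuous_survival by (intro continuous_at_imp_continuous_on) auto
qed

lemma weight_borel [measurable]: "weight t \<in> borel_measurable borel"
  unfolding weight_def using continuous_weight
  by (intro borel_measurable_continuous_on_if) auto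

lemma isCont_weight:
  assumes "0 < s" "s < t"
  shows "isCont (weight t) s"
proof -
  have "continuous_on {0<..<t} (weight t)"
    using continuous_weight by (rule continuous_on_eq) (simp add: weight_def)
  then show ?thesis
    using assms by (simp add: continuous_on_eq_continuous_at)
qed

lemma weight_nonneg: "0 \<le> weight t s"
  using lam_positive[of s] survival_bounds[of s "t - s"] by (auto simp: weight_def)

lemma weight_bound: "\<exists>B. \<forall>t s. weight t s \<le> B"
proof -
  obtain B where B: "\<And>s. s \<ge> 0 \<Longrightarrow> lam s \<le> B"
    using lam_bound by blast
  have "weight t s \<le> B" for t s
  proof (cases "s \<in> {0<..<t}")
    case True
    then have "lam s * survival ell s (t - s) \<le> lam s * 1"
      using lam_positive[of s] survival_bounds[of s "t - s"] by (intro mult_left_mono) auto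
    then show ?thesis
      using True B[of s] by (simp add: weight_def)
  next
    case False
    then have "weight t s = 0"
      unfolding weight_def by (rule if_not_P)
    then show ?thesis
      using lam_positive[of 0] B[of 0] by simp
  qed
  then show ?thesis by blast
qed

lemma averaged_mean_eq:
  assumes "t > 0"
  shows "averaged_mean \<pi> lam \<psi> ell t = (\<integral>z. \<psi> z \<partial>\<pi>) * (LBINT s:{0..t}. weight t s)"
proof -
  have "(LBINT s:{0..t}. lam s * survival ell s (t - s)) = (LBINT s:{0..t}. weight t s)"
    unfolding set_lebesgue_integral_def
    by (rule integral_discrete_difference[where X="{0, t}"])
       (auto simp: weight_def split: split_indicator)
  then show ?thesis
    by (simp add: averaged_mean_def)
qed

text \<open>The integrand is strictly positive on (0, t) by \<open>survival_positive\<close>, and so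
  is the mean of \<open>\<psi>\<close>. This makes the averaged mean a legitimate divisor and the
  quenched mean eventually positive.\<close>

lemma averaged_mean_positive:
  assumes "t > 0"
  shows "averaged_mean \<pi> lam \<psi> ell t > 0"
proof -
  obtain B where B: "\<And>u s. weight u s \<le> B"
    using weight_bound by auto
  have int: "integrable lborel (\<lambda>s. indicator {0..t} s *\<^sub>R weight t s)"
  proof (rule Bochner_Integration.integrable_bound)
    show "integrable lborel (\<lambda>s. indicator {0..t} s * B)"
      by (intro integrable_mult_left integrable_real_indicator) (auto simp: emeasure_lborel_Icc_eq)
    show "AE s in lborel. norm (indicator {0..t} s *\<^sub>R weight t s) \<le> norm (indicator {0..t} s * B)"
    proof (intro always_eventually allI)
      fix s
      show "norm (indicator {0..t} s *\<^sub>R weight t s) \<le> norm (indicator {0..t} s * B)"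
        using weight_nonneg[of t s] B[of t s] by (cases "s \<in> {0..t}") simp_all
    qed
  qed measurable
  have "(LBINT s:{0..t}. weight t s) \<noteq> 0"
  proof
    assume "(LBINT s:{0..t}. weight t s) = 0"
    then have "AE s in lborel. indicator {0..t} s *\<^sub>R weight t s = 0"
      unfolding set_lebesgue_integral_def using int weight_nonneg
      by (subst (asm) integral_nonneg_eq_0_iff_AE) auto
    then have "AE s in lborel. s \<notin> {0<..<t}"
    proof eventually_elim
      case (elim s)
      show ?case
      proof
        assume s: "s \<in> {0<..<t}"
        then have "lam s * survival ell s (t - s) > 0"
          using lam_positive[of s] survival_positive[of s "t - s"] by simp
        then show False
          using elim s by (auto simp: weight_def)
      qed
    qed
    then have "{0<..<t} \<in> null_sets lborel"
      by (subst (asm) AE_iff_null_sets[symmetric]) auto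
    then show False
      using assms by (auto simp: null_sets_def)
  qed
  moreover have "(LBINT s:{0..t}. weight t s) \<ge> 0"
    unfolding set_lebesgue_integral_def using weight_nonneg by (intro integral_nonneg_AE) auto
  ultimately show ?thesis
    using mean_environment_positive assms by (simp add: averaged_mean_eq)
qed

text \<open>This is eps^beta times the quenched mean; with the diverging factor split off, it has a
  finite positive limit.\<close>

definition environment_mean :: "'a \<Rightarrow> real \<Rightarrow> real \<Rightarrow> real" where
  "environment_mean \<omega> t \<epsilon> = (LBINT s:{0..t}. weight t s * env \<omega> (s / \<epsilon>))"

lemma environment_mean_tendsto:
  assumes "\<omega> \<in> space M" "t > 0" "\<kappa> > 0"
    and erg: "\<And>t. t > 0 \<Longrightarrow>
      \<bar>(1 / t) * (LBINT u:{0..t}. \<psi> (Z u \<omega>)) - (\<integral>z. \<psi> z \<partial>\<pi>)\<bar> \<le> C / (1 + t) powr \<kappa>"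
  shows "(environment_mean \<omega> t \<longlongrightarrow> averaged_mean \<pi> lam \<psi> ell t) (at_right 0)"
proof -
  obtain B where B: "\<And>u s. weight u s \<le> B"
    using weight_bound by auto
  obtain V where V: "\<And>z. \<psi> z \<le> V"
    using \<psi>_bound by blast
  have "(LBINT u:{0..t}. env \<omega> u) = (LBINT u:{0..t}. \<psi> (Z u \<omega>))" for t
    unfolding set_lebesgue_integral_def
    by (intro Bochner_Integration.integral_cong) (auto simp: env_def split: split_indicator)
  \<comment> \<open>The ergodic rate, written as a negative power, tends to 0 and so yields the
    limit of the time averages.\<close>
  then have erg': "norm ((1 / t) * (LBINT u:{0..t}. env \<omega> u) - (\<integral>z. \<psi> z \<partial>\<pi>)) \<le> C * (1 + t) powr - \<kappa>" if "t > 0" for t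
    using erg[OF that] by (simp add: powr_minus_divide)
  have "((\<lambda>t. (1 / t) * (LBINT u:{0..t}. env \<omega> u)) \<longlongrightarrow> (\<integral>z. \<psi> z \<partial>\<pi>)) at_top"
  proof (rule LIM_zero_cancel, rule Lim_null_comparison)
    show "\<forall>\<^sub>F t in at_top. norm ((1 / t) * (LBINT u:{0..t}. env \<omega> u) - (\<integral>z. \<psi> z \<partial>\<pi>)) \<le> C * (1 + t) powr - \<kappa>"
      using eventually_gt_at_top[of 0] by eventually_elim (rule erg')
    have "((\<lambda>t. (1 + t) powr - \<kappa>) \<longlongrightarrow> 0) at_top"
      using \<open>\<kappa> > 0\<close> by (intro tendsto_neg_powr filterlim_tendsto_add_at_top[OF tendsto_const] filterlim_ident) auto
    then show "((\<lambda>t. C * (1 + t) powr - \<kappa>) \<longlongrightarrow> 0) at_top"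
      by (rule tendsto_mult_right_zero)
  qed
  then show ?thesis
    unfolding environment_mean_def averaged_mean_eq[OF \<open>t > 0\<close>]
  proof (intro averaging_principle)
    show "\<bar>weight t s\<bar> \<le> B" for s
      using weight_nonneg[of t s] B[of t s] by simp
    show "env \<omega> s \<le> V" for s
      using V by (simp add: env_def)
  qed (use assms isCont_weight env_borel env_positive mean_environment_positive in \<open>auto intro: less_imp_le\<close>)
qed

text \<open>The density of \<open>arrival_intensity\<close> rewritten with arguments clamped at 0:
  \<open>lam\<close> and the path are regular on the nonnegative half line only, yet the density
  must be Borel on the whole line.\<close>

definition rate :: "'a \<Rightarrow> real \<Rightarrow> real \<Rightarrow> real" where
  "rate \<omega> \<epsilon> s = indicator {0..} s * (\<epsilon> powr - \<beta> * lam (max 0 s) * env \<omega> (s / \<epsilon>))"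

lemma arrival_intensity_eq:
  assumes "\<epsilon> > 0"
  shows "arrival_intensity \<beta> lam \<psi> (\<lambda>u. Z u \<omega>) \<epsilon> = density lborel (\<lambda>s. ennreal (rate \<omega> \<epsilon> s))"
proof -
  have "indicator {0..} s * (\<epsilon> powr - \<beta> * lam s * \<psi> (Z (s / \<epsilon>) \<omega>)) = rate \<omega> \<epsilon> s" for s
    using assms by (simp add: rate_def env_def max_def divide_nonneg_pos split: split_indicator)
  then show ?thesis
    unfolding arrival_intensity_def by (simp only:)
qed

lemma rate_borel:
  assumes "\<omega> \<in> space M"
  shows "rate \<omega> \<epsilon> \<in> borel_measurable borel"
proof -
  have [measurable]: "env \<omega> \<in> borel_measurable borel"
    by (rule env_borel[OF assms])
  have [measurable]: "(\<lambda>s. lam (max 0 s)) \<in> borel_measurable borel"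
    by (intro borel_measurable_continuous_onI continuous_on_compose2[OF continuous_lam] continuous_intros) auto
  show ?thesis unfolding rate_def by measurable
qed

lemma marked_arrivals_quenched:
  assumes "\<omega> \<in> space M" "t > 0" "\<epsilon> > 0"
    and "poisson_process (Q \<omega>) (\<Gamma> \<epsilon>) (arrival_intensity \<beta> lam \<psi> (\<lambda>u. Z u \<omega>) \<epsilon>)"
    and "service_times (Q \<omega>) ell (\<Gamma> \<epsilon>) (L \<epsilon>)"
  shows "marked_arrivals (Q \<omega>) (\<Gamma> \<epsilon>) (arrival_intensity \<beta> lam \<psi> (\<lambda>u. Z u \<omega>) \<epsilon>) t (L \<epsilon>) ell kernel"
proof -
  let ?\<mu> = "arrival_intensity \<beta> lam \<psi> (\<lambda>u. Z u \<omega>) \<epsilon>"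
  have "space (sigma_rvs M {0..} Z) = space M"
    unfolding sigma_rvs_def by (simp add: space_measure_of_conv)
  then have Q: "prob_space (Q \<omega>)" "sets (Q \<omega>) = sets M"
    using measurable_space[OF Q_kernel, of \<omega>] assms(1) by (auto simp: space_prob_algebra)
  note \<mu> = arrival_intensity_eq[OF \<open>\<epsilon> > 0\<close>, of \<omega>]
  note [measurable] = rate_borel[OF assms(1), of \<epsilon>]
  obtain B where B: "\<And>s. s \<ge> 0 \<Longrightarrow> lam s \<le> B"
    using lam_bound by blast
  obtain V where V: "\<And>z. \<psi> z \<le> V"
    using \<psi>_bound by blast
  have "emeasure ?\<mu> {..<t} = (\<integral>\<^sup>+s. ennreal (rate \<omega> \<epsilon> s) * indicator {..<t} s \<partial>lborel)"
    unfolding \<mu> by (rule emeasure_density) simp_all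
  also have "\<dots> \<le> (\<integral>\<^sup>+s. ennreal (\<epsilon> powr - \<beta> * B * V) * indicator {0..t} s \<partial>lborel)"
  proof (rule nn_integral_mono)
    fix s
    have "\<epsilon> powr - \<beta> * lam (max 0 s) * env \<omega> (s / \<epsilon>) \<le> \<epsilon> powr - \<beta> * B * V"
      using B[of "max 0 s"] V lam_positive[of "max 0 s"] env_positive[of \<omega>]
      by (intro mult_mono) (auto simp: env_def less_imp_le intro: order_trans)
    then show "ennreal (rate \<omega> \<epsilon> s) * indicator {..<t} s \<le> ennreal (\<epsilon> powr - \<beta> * B * V) * indicator {0..t} s"
      by (auto simp: rate_def intro: ennreal_leI split: split_indicator)
  qed
  also have "\<dots> < \<infinity>"
    using \<open>t > 0\<close> by (simp add: nn_integral_cmult_indicator emeasure_lborel_Icc_eq ennreal_mult_less_top)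
  finally have fin: "emeasure ?\<mu> {..<t} < \<infinity>" .
  have "emeasure ?\<mu> {..0} = (\<integral>\<^sup>+s. ennreal (rate \<omega> \<epsilon> s) * indicator {..0} s \<partial>lborel)"
    unfolding \<mu> by (rule emeasure_density) simp_all
  also have "\<dots> = (\<integral>\<^sup>+s. 0 \<partial>(lborel :: real measure))"
  proof (rule nn_integral_cong_AE)
    show "AE s in lborel. ennreal (rate \<omega> \<epsilon> s) * indicator {..0} s = 0"
      using AE_lborel_singleton[of 0] by eventually_elim (auto simp: rate_def split: split_indicator)
  qed
  finally have zero: "emeasure ?\<mu> {..0} = 0" by simp
  show ?thesis
  proof (intro marked_arrivals.intro poisson_arrivals.intro poisson_arrivals_axioms.intro
      marked_arrivals_axioms.intro)
    show "\<Gamma> \<epsilon> k \<in> borel_measurable (Q \<omega>)" "L \<epsilon> k \<in> borel_measurable (Q \<omega>)" for k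
      unfolding measurable_cong_sets[OF Q(2) refl]
      using \<Gamma>_measurable L_measurable \<open>\<epsilon> > 0\<close> by auto
    show "sets ?\<mu> = sets borel"
      by (simp add: arrival_intensity_def)
  qed (use Q fin zero assms kernel_measurable in \<open>auto simp: kernel_def\<close>)
qed

lemma quenched_deviation:
  assumes "\<omega> \<in> space M" "t > 0" "\<epsilon> > 0"
    and "poisson_process (Q \<omega>) (\<Gamma> \<epsilon>) (arrival_intensity \<beta> lam \<psi> (\<lambda>u. Z u \<omega>) \<epsilon>)"
    and "service_times (Q \<omega>) ell (\<Gamma> \<epsilon>) (L \<epsilon>)"
  defines "m \<equiv> \<epsilon> powr - \<beta> * environment_mean \<omega> t \<epsilon>"
  shows "quenched_mean (Q \<omega>) (\<Gamma> \<epsilon>) (L \<epsilon>) t = m"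
    and "\<delta> > 0 \<Longrightarrow> measure (Q \<omega>) {x \<in> space (Q \<omega>). \<delta> \<le> \<bar>a * active_jobs (\<Gamma> \<epsilon>) (L \<epsilon>) t x - c\<bar>}
      \<le> (a\<^sup>2 * m + (a * m - c)\<^sup>2) / \<delta>\<^sup>2"
proof -
  let ?\<mu> = "arrival_intensity \<beta> lam \<psi> (\<lambda>u. Z u \<omega>) \<epsilon>"
  interpret A: marked_arrivals "Q \<omega>" "\<Gamma> \<epsilon>" ?\<mu> t "L \<epsilon>" ell kernel
    by (rule marked_arrivals_quenched[OF assms(1-5)])
  note [measurable] = env_borel[OF assms(1)] rate_borel[OF assms(1), of \<epsilon>]
  note \<mu> = arrival_intensity_eq[OF \<open>\<epsilon> > 0\<close>, of \<omega>]
  have sets\<mu>: "sets ?\<mu> = sets borel"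
    by (rule A.sets_\<mu>)
  have tail: "A.tail s = ennreal (survival ell s (t - s))" if "0 < s" "s < t" for s
  proof -
    have "{r. (s, r) \<in> A.overshoot} = {t - s<..}"
      by (auto simp: A.overshoot_def)
    moreover have "emeasure (service_law ell s) {t - s<..} = measure (service_law ell s) {t - s<..}"
      using that by (intro finite_measure.emeasure_eq_measure prob_space.axioms service_law_prob) simp
    ultimately show ?thesis
      using that by (simp add: A.tail_def kernel_def survival_eq_measure)
  qed
  have [measurable]: "(\<lambda>s. indicator {..<t} s * A.tail s) \<in> borel_measurable borel"
    by measurable
  have "(\<integral>\<^sup>+s. A.tail s \<partial>A.\<mu>T) = (\<integral>\<^sup>+s. indicator {..<t} s * A.tail s \<partial>?\<mu>)"
    unfolding A.\<mu>T_def by (rule nn_integral_density) (auto simp: measurable_cong_sets[OF sets\<mu> refl])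
  also have "\<dots> = (\<integral>\<^sup>+s. ennreal (rate \<omega> \<epsilon> s) * (indicator {..<t} s * A.tail s) \<partial>lborel)"
    unfolding \<mu> by (rule nn_integral_density) simp_all
  \<comment> \<open>Inside (0, t) the kernel tail is the survival function. Elsewhere, apart from
    the two endpoints, both integrands are 0, so the artificial values of \<open>kernel\<close> at s
    <= 0 do not enter.\<close>
  also have "\<dots> = (\<integral>\<^sup>+s. ennreal (\<epsilon> powr - \<beta> * (indicator {0..t} s *\<^sub>R (weight t s * env \<omega> (s / \<epsilon>)))) \<partial>lborel)"
  proof (rule nn_integral_cong_AE)
    show "AE s in lborel. ennreal (rate \<omega> \<epsilon> s) * (indicator {..<t} s * A.tail s)
        = ennreal (\<epsilon> powr - \<beta> * (indicator {0..t} s *\<^sub>R (weight t s * env \<omega> (s / \<epsilon>))))"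
      using AE_lborel_singleton[of 0] AE_lborel_singleton[of t]
    proof eventually_elim
      case (elim s)
      show ?case
      proof (cases "0 < s \<and> s < t")
        case True
        then show ?thesis
          using lam_positive[of s] env_positive[of \<omega> "s / \<epsilon>"] survival_bounds[of s "t - s"]
          by (simp add: rate_def tail weight_def mult_ac flip: ennreal_mult'')
      next
        case False
        then show ?thesis
          using elim by (auto simp: rate_def weight_def split: split_indicator)
      qed
    qed
  qed
  finally have nn: "(\<integral>\<^sup>+s. A.tail s \<partial>A.\<mu>T)
      = (\<integral>\<^sup>+s. ennreal (\<epsilon> powr - \<beta> * (indicator {0..t} s *\<^sub>R (weight t s * env \<omega> (s / \<epsilon>)))) \<partial>lborel)" .
  have "m = (\<integral>s. \<epsilon> powr - \<beta> * (indicator {0..t} s *\<^sub>R (weight t s * env \<omega> (s / \<epsilon>))) \<partial>lborel)"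
    by (simp add: m_def environment_mean_def set_lebesgue_integral_def)
  also have "\<dots> = enn2real (\<integral>\<^sup>+s. A.tail s \<partial>A.\<mu>T)"
    unfolding nn using weight_nonneg env_positive
    by (intro integral_eq_nn_integral) (auto simp: less_imp_le)
  finally have m: "enn2real (\<integral>\<^sup>+s. A.tail s \<partial>A.\<mu>T) = m" by simp
  show "quenched_mean (Q \<omega>) (\<Gamma> \<epsilon>) (L \<epsilon>) t = m"
    using A.active_jobs_moments(3) by (simp add: quenched_mean_def m)
  show "measure (Q \<omega>) {x \<in> space (Q \<omega>). \<delta> \<le> \<bar>a * active_jobs (\<Gamma> \<epsilon>) (L \<epsilon>) t x - c\<bar>}
      \<le> (a\<^sup>2 * m + (a * m - c)\<^sup>2) / \<delta>\<^sup>2" if "\<delta> > 0"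
    using A.active_jobs_deviation[OF that, of a c] by (simp add: m)
qed

lemma quenched_law_of_large_numbers:
  assumes "\<omega> \<in> space M" "t > 0" "\<kappa> > 0"
    and erg: "\<And>t. t > 0 \<Longrightarrow>
      \<bar>(1 / t) * (LBINT u:{0..t}. \<psi> (Z u \<omega>)) - (\<integral>z. \<psi> z \<partial>\<pi>)\<bar> \<le> C / (1 + t) powr \<kappa>"
    and pp: "\<And>\<epsilon>. \<epsilon> > 0 \<Longrightarrow>
      poisson_process (Q \<omega>) (\<Gamma> \<epsilon>) (arrival_intensity \<beta> lam \<psi> (\<lambda>u. Z u \<omega>) \<epsilon>)"
    and st: "\<And>\<epsilon>. \<epsilon> > 0 \<Longrightarrow> service_times (Q \<omega>) ell (\<Gamma> \<epsilon>) (L \<epsilon>)"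
  shows "converges_in_prob (Q \<omega>)
      (\<lambda>\<epsilon> x. active_jobs (\<Gamma> \<epsilon>) (L \<epsilon>) t x / quenched_mean (Q \<omega>) (\<Gamma> \<epsilon>) (L \<epsilon>) t) 1 (at_right 0)"
    and "converges_in_prob (Q \<omega>)
      (\<lambda>\<epsilon> x. \<epsilon> powr \<beta> * active_jobs (\<Gamma> \<epsilon>) (L \<epsilon>) t x / averaged_mean \<pi> lam \<psi> ell t) 1 (at_right 0)"
proof -
  let ?G = "environment_mean \<omega> t" and ?m = "averaged_mean \<pi> lam \<psi> ell t"
  have G: "(?G \<longlongrightarrow> ?m) (at_right 0)"
    by (rule environment_mean_tendsto[OF assms(1-3) erg])
  have m: "?m > 0"
    by (rule averaged_mean_positive[OF \<open>t > 0\<close>])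
  have pow: "((\<lambda>\<epsilon>. \<epsilon> powr \<beta>) \<longlongrightarrow> 0) (at_right 0)"
    using tendsto_powr2[of "\<lambda>\<epsilon>::real. \<epsilon>" 0 "at_right 0" "\<lambda>_. \<beta>" \<beta>] \<beta>_positive
    by (auto simp: eventually_at_filter less_imp_le)
  have pos: "eventually (\<lambda>\<epsilon>::real. \<epsilon> > 0) (at_right 0)"
    by (simp add: eventually_at_filter)
  note dev = quenched_deviation[OF assms(1,2) _ pp st]
  show "converges_in_prob (Q \<omega>)
      (\<lambda>\<epsilon> x. active_jobs (\<Gamma> \<epsilon>) (L \<epsilon>) t x / quenched_mean (Q \<omega>) (\<Gamma> \<epsilon>) (L \<epsilon>) t) 1 (at_right 0)"
    unfolding converges_in_prob_def
  proof (intro allI impI)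
    fix \<delta> :: real assume "\<delta> > 0"
    let ?p = "\<lambda>\<epsilon>. measure (Q \<omega>) {x \<in> space (Q \<omega>).
      \<delta> \<le> \<bar>active_jobs (\<Gamma> \<epsilon>) (L \<epsilon>) t x / quenched_mean (Q \<omega>) (\<Gamma> \<epsilon>) (L \<epsilon>) t - 1\<bar>}"
    have "((\<lambda>\<epsilon>. \<epsilon> powr \<beta> / ?G \<epsilon> / \<delta>\<^sup>2) \<longlongrightarrow> 0 / ?m / \<delta>\<^sup>2) (at_right 0)"
      using m \<open>\<delta> > 0\<close> by (intro tendsto_divide pow G tendsto_const) auto
    then have lim: "((\<lambda>\<epsilon>. \<epsilon> powr \<beta> / ?G \<epsilon> / \<delta>\<^sup>2) \<longlongrightarrow> 0) (at_right 0)"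
      by simp
    have le: "eventually (\<lambda>\<epsilon>. ?p \<epsilon> \<le> \<epsilon> powr \<beta> / ?G \<epsilon> / \<delta>\<^sup>2) (at_right 0)"
      using pos order_tendstoD(1)[OF G m]
    proof eventually_elim
      case (elim \<epsilon>)
      define q where "q = \<epsilon> powr - \<beta> * ?G \<epsilon>"
      have "q > 0"
        using elim by (simp add: q_def)
      \<comment> \<open>With \<open>q\<close> the quenched mean, the choice a = 1/q and c = 1 makes
        the bias vanish and leaves only the variance term.\<close>
      have "?p \<epsilon> \<le> ((1 / q)\<^sup>2 * q + ((1 / q) * q - 1)\<^sup>2) / \<delta>\<^sup>2"
        using dev(2)[OF elim(1) elim(1) elim(1) \<open>\<delta> > 0\<close>, of "1 / q" 1]
        unfolding dev(1)[OF elim(1) elim(1) elim(1)] q_def[symmetric] by simp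
      also have "\<dots> = 1 / q / \<delta>\<^sup>2"
        using \<open>q > 0\<close> by (simp add: power2_eq_square)
      also have "1 / q = \<epsilon> powr \<beta> / ?G \<epsilon>"
        using elim by (simp add: q_def powr_minus field_simps)
      finally show ?case .
    qed
    show "(?p \<longlongrightarrow> 0) (at_right 0)"
      by (rule tendsto_sandwich[OF _ le tendsto_const lim]) simp
  qed
  show "converges_in_prob (Q \<omega>)
      (\<lambda>\<epsilon> x. \<epsilon> powr \<beta> * active_jobs (\<Gamma> \<epsilon>) (L \<epsilon>) t x / ?m) 1 (at_right 0)"
    unfolding converges_in_prob_def
  proof (intro allI impI)
    fix \<delta> :: real assume "\<delta> > 0"
    let ?p = "\<lambda>\<epsilon>. measure (Q \<omega>) {x \<in> space (Q \<omega>).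
      \<delta> \<le> \<bar>\<epsilon> powr \<beta> * active_jobs (\<Gamma> \<epsilon>) (L \<epsilon>) t x / ?m - 1\<bar>}"
    \<comment> \<open>The choice a = eps^beta / \<open>?m\<close> and c = 1: the first summand is
      the Poisson variance, of order eps^beta, and the second is the squared averaging
      error.\<close>
    let ?b = "\<lambda>\<epsilon>. (\<epsilon> powr \<beta> * ?G \<epsilon> / ?m\<^sup>2 + (?G \<epsilon> / ?m - 1)\<^sup>2) / \<delta>\<^sup>2"
    have "(?b \<longlongrightarrow> (0 * ?m / ?m\<^sup>2 + (?m / ?m - 1)\<^sup>2) / \<delta>\<^sup>2) (at_right 0)"
      using m \<open>\<delta> > 0\<close>
      by (intro tendsto_divide tendsto_add tendsto_mult tendsto_diff tendsto_power pow G tendsto_const) auto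
    then have lim: "(?b \<longlongrightarrow> 0) (at_right 0)"
      using m by simp
    have le: "eventually (\<lambda>\<epsilon>. ?p \<epsilon> \<le> ?b \<epsilon>) (at_right 0)"
      using pos
    proof eventually_elim
      case (elim \<epsilon>)
      have a: "\<epsilon> powr \<beta> / ?m * (\<epsilon> powr - \<beta> * ?G \<epsilon>) = ?G \<epsilon> / ?m"
        using elim by (simp add: powr_minus)
      have "(\<epsilon> powr \<beta> / ?m)\<^sup>2 * (\<epsilon> powr - \<beta> * ?G \<epsilon>) = \<epsilon> powr \<beta> / ?m * (\<epsilon> powr \<beta> / ?m * (\<epsilon> powr - \<beta> * ?G \<epsilon>))"
        by (simp only: power2_eq_square mult.assoc)
      also have "\<dots> = \<epsilon> powr \<beta> * ?G \<epsilon> / ?m\<^sup>2"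
        unfolding a by (simp add: power2_eq_square)
      finally have b: "(\<epsilon> powr \<beta> / ?m)\<^sup>2 * (\<epsilon> powr - \<beta> * ?G \<epsilon>) = \<epsilon> powr \<beta> * ?G \<epsilon> / ?m\<^sup>2" .
      show ?case
        using dev(2)[OF elim elim elim \<open>\<delta> > 0\<close>, of "\<epsilon> powr \<beta> / ?m" 1]
        unfolding a b by simp
    qed
    show "(?p \<longlongrightarrow> 0) (at_right 0)"
      by (rule tendsto_sandwich[OF _ le tendsto_const lim]) simp
  qed
qed

end

theorem theorem3p5:
  fixes M :: "'a measure"
    and Z :: "real \<Rightarrow> 'a \<Rightarrow> real ^ 'd"
    and K :: "real \<Rightarrow> real ^ 'd \<Rightarrow> (real ^ 'd) measure"
    and \<pi> :: "(real ^ 'd) measure"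
    and lam :: "real \<Rightarrow> real"
    and \<psi> :: "real ^ 'd \<Rightarrow> real"
    and ell :: "real \<Rightarrow> real \<Rightarrow> real"
    and \<alpha> \<beta> :: real
    and Q :: "'a \<Rightarrow> 'a measure"
    and \<Gamma> :: "real \<Rightarrow> nat \<Rightarrow> 'a \<Rightarrow> ennreal"
    and L :: "real \<Rightarrow> nat \<Rightarrow> 'a \<Rightarrow> real"
  assumes "queue_in_random_environment M Z K \<pi> lam \<psi> ell \<alpha> \<beta> Q \<Gamma> L"
  shows "(AE \<omega> in M. \<forall>t>0.
            converges_in_prob (Q \<omega>)
              (\<lambda>\<epsilon> x. active_jobs (\<Gamma> \<epsilon>) (L \<epsilon>) t x / quenched_mean (Q \<omega>) (\<Gamma> \<epsilon>) (L \<epsilon>) t)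
              1 (at_right 0)) \<and>
         (AE \<omega> in M. \<forall>t>0.
            converges_in_prob (Q \<omega>)
              (\<lambda>\<epsilon> x. \<epsilon> powr \<beta> * active_jobs (\<Gamma> \<epsilon>) (L \<epsilon>) t x / averaged_mean \<pi> lam \<psi> ell t)
              1 (at_right 0))"
proof -
  interpret queue_in_random_environment M Z K \<pi> lam \<psi> ell \<alpha> \<beta> Q \<Gamma> L
    by fact
  \<comment> \<open>Any exponent in (0, 1/2) would serve; 1/4 is one choice.\<close>
  obtain C where "AE \<omega> in M. \<forall>t>0. \<bar>(1 / t) * (LBINT u:{0..t}. \<psi> (Z u \<omega>)) - (\<integral>z. \<psi> z \<partial>\<pi>)\<bar>
      \<le> C \<omega> / (1 + t) powr (1 / 4)"
    using ergodicity[of "1 / 4"] by auto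
  \<comment> \<open>None of these almost sure statements depends on a chosen t or \<epsilon>, so one
    null set of environments covers all times and scales.\<close>
  with arrivals services AE_space
  have "AE \<omega> in M. \<forall>t>0.
      converges_in_prob (Q \<omega>)
        (\<lambda>\<epsilon> x. active_jobs (\<Gamma> \<epsilon>) (L \<epsilon>) t x / quenched_mean (Q \<omega>) (\<Gamma> \<epsilon>) (L \<epsilon>) t) 1 (at_right 0) \<and>
      converges_in_prob (Q \<omega>)
        (\<lambda>\<epsilon> x. \<epsilon> powr \<beta> * active_jobs (\<Gamma> \<epsilon>) (L \<epsilon>) t x / averaged_mean \<pi> lam \<psi> ell t) 1 (at_right 0)"
  proof eventually_elim
    case (elim \<omega>)
    show ?case
      using quenched_law_of_large_numbers[OF elim(3), of _ "1 / 4" "C \<omega>"] elim by simp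
  qed
  then show ?thesis
    by (auto elim: eventually_mono)
qed

end
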